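(* Assume $Y \sim \mathrm{N}(0, \Sigma(\psi))$ (the linear mixed model with known $\beta = 0$). If, for a fixed $\psi\in\mathbb{P}$ and a number $\bar a$ with $\bar{a}^2<1/8$, it holds for every $v\in\mathbb{S}^{r-1}$ that $a(v,\psi)\leq\bar a$, then \[ \vert g(t;v,\psi)-\phi(t)\vert\leq 0.14\{4+0.29(1-8\bar a^2)^{-2}\}\,\bar a \] for every $t\in\mathbb{R}$ and $v\in\mathbb{S}^{r-1}$.
   Context: Model: $Z \in \mathbb{R}^{n\times q}$ is a non-stochastic matrix. For $\psi = [\psi_1,\dots,\psi_r]^{\mathsf T} \in \mathbb{R}^r$, $\Psi(\psi) \in \mathbb{R}^{q\times q}$ is a symmetric matrix each of whose elements is either known to be zero or equal to one of $\psi_1,\dots,\psi_{r-1}$; thus $\Psi(\psi) = \sum_{j=1}^{r}\psi_j H_j$, where $H_j = \partial \Psi/\partial\psi_j$ has entries zero and one, $H_j\neq 0$ for $j<r$, and $H_r = 0$. For any $v\in\mathbb{R}^r$ (not only elements of the parameter set), $\Psi(v) = \sum_j v_j H_j$ and $\Sigma(v) = Z\Psi(v)Z^{\mathsf T} + v_r I_n$. The parameter set is $\mathbb{P} = \{\psi\in\mathbb{R}^r : \Psi(\psi) \geq 0,\ \psi_r>0\}$, where $\geq 0$ means positive semi-definite. Score and information: for $\psi \in \mathbb{P}$ let $A_j(\psi) = \Sigma(\psi)^{-1/2}\{\partial\Sigma(\psi)/\partial\psi_j\}\Sigma(\psi)^{-1/2}$, so $A_j = \Sigma^{-1/2}ZH_jZ^{\mathsf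 T}\Sigma^{-1/2}$ for $j<r$ and $A_r=\Sigma^{-1}$. With $R=\Sigma(\psi)^{-1/2}Y$, the score $S(\psi)\in\mathbb{R}^r$ (gradient in $\psi$ of the log-likelihood) has elements $S_j(\psi)=\frac12\{R^{\mathsf T}A_jR-\mathrm{tr}(A_j)\}$, and the Fisher information is the $r\times r$ matrix $\mathcal{I}(\psi)$ with elements $\mathcal{I}_{ij}(\psi)=\mathrm{tr}(A_iA_j)/2$. When $\mathcal{I}(\psi)$ is invertible, $W^S(\psi)=\mathcal{I}(\psi)^{-1/2}S(\psi)$ (symmetric square root). Notation: $\|\cdot\|$ is the Euclidean norm of vectors and the spectral norm of matrices, $\|\cdot\|_F$ the Frobenius norm; $\mathbb{S}^{r-1}=\{v\in\mathbb{R}^r:\|v\|=1\}$. For $v\in\mathbb{R}^r$, $\psi\in\mathbb{P}$, $A(v,\psi)=\sum_{j=1}^r v_jA_j(\psi)=\Sigma(\psi)^{-1/2}\Sigma(v)\Sigma(\psi)^{-1/2}$; $a(v,\psi)=\|A(v,\psi)\|/\|A(v,\psi)\|_F$ if $\|A(v,\psi)\|_F>0$ and $a(v,\psi)=1$ otherwise. $g(\cdot;v,\psi)$ is the density of $v^{\mathsf T}W^S(\psi)$ when $\psi$ is the true parameter, and $\phi$ is the standard normal density. *)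

theory Defs
  imports "HOL-Probability.Probability"
begin

section \<open>Matrix preliminaries\<close>

definition psd :: "real ^ 'n ^ 'n \<Rightarrow> bool" where
  "psd A \<longleftrightarrow> transpose A = A \<and> (\<forall>x. 0 \<le> x \<bullet> (A *v x))"

text \<open>The symmetric square root; it exists and is unique whenever \<open>A\<close> is positive semi-definite.\<close>

definition msqrt :: "real ^ 'n ^ 'n \<Rightarrow> real ^ 'n ^ 'n" where
  "msqrt A = (THE B. psd B \<and> B ** B = A)"

definition inv_msqrt :: "real ^ 'n ^ 'n \<Rightarrow> real ^ 'n ^ 'n" where
  "inv_msqrt A = matrix_inv (msqrt A)"

definition spectral_norm :: "real ^ 'n ^ 'm \<Rightarrow> real" where
  "spectral_norm A = onorm (\<lambda>x. A *v x)"

definition frobenius_norm :: "real ^ 'n ^ 'm \<Rightarrow> real" where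
  "frobenius_norm A = sqrt (\<Sum>i\<in>UNIV. \<Sum>j\<in>UNIV. (A $ i $ j)\<^sup>2)"

lemma frobenius_norm_eq_norm: "frobenius_norm A = norm A"
  by (simp add: frobenius_norm_def norm_vec_def L2_set_def sum_nonneg)


section \<open>Probabilistic preliminaries\<close>

text \<open>Density of \<open>N(m, S)\<close> for a positive definite covariance matrix \<open>S\<close>.\<close>

definition mvnormal_density :: "real ^ 'n \<Rightarrow> real ^ 'n ^ 'n \<Rightarrow> real ^ 'n \<Rightarrow> real" where
  "mvnormal_density m S y =
     exp (- ((y - m) \<bullet> (matrix_inv S *v (y - m))) / 2) / sqrt ((2 * pi) ^ CARD('n) * det S)"

text \<open>A density is determined only almost everywhere, so a pointwise statement about ``the''
  density refers to its continuous version, which is unique by the lemma below.\<close>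

definition continuous_density :: "'a measure \<Rightarrow> ('a \<Rightarrow> real) \<Rightarrow> (real \<Rightarrow> real) \<Rightarrow> bool" where
  "continuous_density M X g \<longleftrightarrow>
     continuous_on UNIV g \<and> (\<forall>t. 0 \<le> g t) \<and> distributed M lborel X (\<lambda>t. ennreal (g t))"

lemma continuous_density_unique:
  assumes "continuous_density M X g" "continuous_density M X h"
  shows "g = h"
proof -
  have c: "continuous_on UNIV g" "continuous_on UNIV h"
    using assms by (auto simp: continuous_density_def)
  have m [measurable]: "g \<in> borel_measurable borel" "h \<in> borel_measurable borel"
    using c by (auto intro: borel_measurable_continuous_onI)
  have "AE t in lborel. ennreal (g t) = ennreal (h t)"
  proof (rule sigma_finite_measure.density_unique)
    show "sigma_finite_measure (lborel :: real measure)"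
      by (rule sigma_finite_lborel)
    show "density lborel (\<lambda>t. ennreal (g t)) = density lborel (\<lambda>t. ennreal (h t))"
      using assms by (auto simp: continuous_density_def distributed_def)
  qed simp_all
  then have ae: "AE t in lborel. g t = h t"
    by eventually_elim (use assms in \<open>auto simp: continuous_density_def\<close>)
  have op: "open {t. g t \<noteq> h t}"
    using c by (intro open_Collect_neq) auto
  have "{t. g t \<noteq> h t} \<in> null_sets lborel"
    using ae op by (subst (asm) AE_iff_null) auto
  then have "negligible {t. g t \<noteq> h t}"
    unfolding negligible_iff_null_sets by (rule null_sets_completionI)
  then have "{t. g t \<noteq> h t} = {}"
    using op open_not_negligible[of "{t. g t \<noteq> h t}"] by blast
  then show ?thesis
    by auto
qed


section \<open>The variance component model\<close>

text \<open>
  Parameters live in \<open>real ^ 'r\<close>; the distinguished index \<open>l :: 'r\<close> is the position of the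
  error variance, i.e. it plays the role of the last index.
\<close>

definition Psi :: "('r::finite \<Rightarrow> real ^ 'q ^ 'q) \<Rightarrow> real ^ 'r \<Rightarrow> real ^ 'q ^ 'q" where
  "Psi H v = (\<Sum>j\<in>UNIV. (v $ j) *\<^sub>R H j)"

definition covariance_pattern :: "('r::finite \<Rightarrow> real ^ 'q ^ 'q) \<Rightarrow> 'r \<Rightarrow> bool" where
  "covariance_pattern H l \<longleftrightarrow>
     (\<forall>v. transpose (Psi H v) = Psi H v) \<and>
     (\<forall>a b. (\<forall>v. Psi H v $ a $ b = 0) \<or> (\<exists>j. j \<noteq> l \<and> (\<forall>v. Psi H v $ a $ b = v $ j))) \<and>
     (\<forall>j. j \<noteq> l \<longrightarrow> H j \<noteq> 0) \<and> H l = 0"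

lemma Psi_axis: "Psi H (axis j 1) = H j"
proof -
  have "Psi H (axis j 1) = (\<Sum>k\<in>UNIV. if k = j then H k else 0)"
    unfolding Psi_def by (rule sum.cong) (auto simp: axis_def)
  then show ?thesis by simp
qed

lemma covariance_pattern_entries:
  assumes "covariance_pattern H l"
  shows "H j $ a $ b \<in> {0, 1}"
proof -
  have "Psi H (axis j 1) $ a $ b = 0 \<or> (\<exists>k. Psi H (axis j 1) $ a $ b = axis j 1 $ k)"
    using assms unfolding covariance_pattern_def by blast
  then show ?thesis
    unfolding Psi_axis by (auto simp: axis_def split: if_splits)
qed

definition Sigma_mat ::
    "real ^ 'q ^ 'n \<Rightarrow> ('r::finite \<Rightarrow> real ^ 'q ^ 'q) \<Rightarrow> 'r \<Rightarrow> real ^ 'r \<Rightarrow> real ^ 'n ^ 'n" where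
  "Sigma_mat Z H l v = Z ** Psi H v ** transpose Z + (v $ l) *\<^sub>R mat 1"

definition param_set :: "('r::finite \<Rightarrow> real ^ 'q ^ 'q) \<Rightarrow> 'r \<Rightarrow> (real ^ 'r) set" where
  "param_set H l = {\<psi>. psd (Psi H \<psi>) \<and> 0 < \<psi> $ l}"

text \<open>The partial derivative of the covariance matrix with respect to the \<open>j\<close>-th parameter.\<close>

definition dSigma ::
    "real ^ 'q ^ 'n \<Rightarrow> ('r::finite \<Rightarrow> real ^ 'q ^ 'q) \<Rightarrow> 'r \<Rightarrow> real ^ 'r \<Rightarrow> 'r \<Rightarrow> real ^ 'n ^ 'n" where
  "dSigma Z H l \<psi> j = vector_derivative (\<lambda>s. Sigma_mat Z H l (\<psi> + s *\<^sub>R axis j 1)) (at 0)"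

lemma Sigma_mat_line:
  "Sigma_mat Z H l (\<psi> + s *\<^sub>R w) = Sigma_mat Z H l \<psi> + s *\<^sub>R Sigma_mat Z H l w"
proof -
  have psi: "Psi H (\<psi> + s *\<^sub>R w) = Psi H \<psi> + s *\<^sub>R Psi H w"
    by (simp add: Psi_def scaleR_add_left sum.distrib scaleR_sum_right)
  have add: "(A + B) ** C = A ** C + B ** C" for A B :: "real ^ 'q ^ 'n" and C :: "real ^ 'n ^ 'q"
    by (simp add: matrix_matrix_mult_def vec_eq_iff distrib_right sum.distrib)
  show ?thesis
    unfolding Sigma_mat_def psi matrix_add_ldistrib add matrix_scalar_ac
    by (simp only: flip: scalar_matrix_assoc) (simp add: scaleR_add_left scaleR_add_right)
qed

lemma dSigma_eq_Sigma_mat: "dSigma Z H l \<psi> j = Sigma_mat Z H l (axis j 1)"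
  unfolding dSigma_def Sigma_mat_line
  by (rule vector_derivative_at) (auto intro!: derivative_eq_intros)

lemma dSigma_eq:
  assumes "covariance_pattern H l"
  shows "dSigma Z H l \<psi> j = (if j = l then mat 1 else Z ** H j ** transpose Z)"
proof -
  have "axis j 1 $ l = (if j = l then 1 else 0 :: real)"
    by (simp add: axis_def)
  then show ?thesis
    using assms
    by (simp add: dSigma_eq_Sigma_mat Sigma_mat_def Psi_axis covariance_pattern_def)
qed

definition A_mat ::
    "real ^ 'q ^ 'n \<Rightarrow> ('r::finite \<Rightarrow> real ^ 'q ^ 'q) \<Rightarrow> 'r \<Rightarrow> real ^ 'r \<Rightarrow> 'r \<Rightarrow> real ^ 'n ^ 'n" where
  "A_mat Z H l \<psi> j =
     inv_msqrt (Sigma_mat Z H l \<psi>) ** dSigma Z H l \<psi> j ** inv_msqrt (Sigma_mat Z H l \<psi>)"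

text \<open>The gradient in \<open>\<psi>\<close> of the Gaussian log-likelihood at the observation \<open>y\<close>.\<close>

definition score ::
    "real ^ 'q ^ 'n \<Rightarrow> ('r::finite \<Rightarrow> real ^ 'q ^ 'q) \<Rightarrow> 'r \<Rightarrow> real ^ 'r \<Rightarrow> real ^ 'n \<Rightarrow> real ^ 'r" where
  "score Z H l \<psi> y =
     (let R = inv_msqrt (Sigma_mat Z H l \<psi>) *v y in
      \<chi> j. (R \<bullet> (A_mat Z H l \<psi> j *v R) - trace (A_mat Z H l \<psi> j)) / 2)"

definition fisher_info ::
    "real ^ 'q ^ 'n \<Rightarrow> ('r::finite \<Rightarrow> real ^ 'q ^ 'q) \<Rightarrow> 'r \<Rightarrow> real ^ 'r \<Rightarrow> real ^ 'r ^ 'r" where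
  "fisher_info Z H l \<psi> = (\<chi> i j. trace (A_mat Z H l \<psi> i ** A_mat Z H l \<psi> j) / 2)"

definition std_score ::
    "real ^ 'q ^ 'n \<Rightarrow> ('r::finite \<Rightarrow> real ^ 'q ^ 'q) \<Rightarrow> 'r \<Rightarrow> real ^ 'r \<Rightarrow> real ^ 'n \<Rightarrow> real ^ 'r" where
  "std_score Z H l \<psi> y = inv_msqrt (fisher_info Z H l \<psi>) *v score Z H l \<psi> y"

definition A_dir ::
    "real ^ 'q ^ 'n \<Rightarrow> ('r::finite \<Rightarrow> real ^ 'q ^ 'q) \<Rightarrow> 'r \<Rightarrow> real ^ 'r \<Rightarrow> real ^ 'r \<Rightarrow> real ^ 'n ^ 'n" where
  "A_dir Z H l v \<psi> = (\<Sum>j\<in>UNIV. (v $ j) *\<^sub>R A_mat Z H l \<psi> j)"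

definition a_ratio ::
    "real ^ 'q ^ 'n \<Rightarrow> ('r::finite \<Rightarrow> real ^ 'q ^ 'q) \<Rightarrow> 'r \<Rightarrow> real ^ 'r \<Rightarrow> real ^ 'r \<Rightarrow> real" where
  "a_ratio Z H l v \<psi> =
     (if frobenius_norm (A_dir Z H l v \<psi>) > 0
      then spectral_norm (A_dir Z H l v \<psi>) / frobenius_norm (A_dir Z H l v \<psi>) else 1)"

end

theory Submission
  imports Defs
begin

text \<open>Fix a unit vector \<open>v\<close> and put \<open>u = I\<^sup>-\<^sup>1\<^sup>/\<^sup>2 v\<close>, where \<open>I\<close> is the Fisher information. Then \<open>v\<close> times
the standardized score is \<open>u\<close> times the score, that is \<open>(R \<bullet> D R - tr D) / 2\<close> with \<open>D = A(u, \<psi>)\<close> and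
\<open>R\<close> a standard Gaussian vector. The standardization forces \<open>\<parallel>D\<parallel>\<^sub>F\<^sup>2 = 2\<close>, and the hypothesis on the
ratio, which is invariant under scaling of \<open>u\<close>, bounds the spectral norm of \<open>D\<close> by \<open>\<surd>2 a\<close>.
In an orthonormal eigenbasis of \<open>D\<close> the statistic becomes \<open>\<Sum>\<^sub>i d\<^sub>i (X\<^sub>i\<^sup>2 - 1) / 2\<close> with independent
standard normal \<open>X\<^sub>i\<close>, \<open>\<Sum>\<^sub>i d\<^sub>i\<^sup>2 = 2\<close> and \<open>\<bar>d\<^sub>i\<bar> \<le> \<surd>2 a\<close>.

Its characteristic function is \<open>\<Phi>(s) = \<Prod>\<^sub>i exp (\<lambda>(s d\<^sub>i))\<close>, where
\<open>\<lambda>(\<theta>) = - i \<theta> / 2 - Ln (1 - i \<theta>) / 2\<close> differs from \<open>- \<theta>\<^sup>2 / 4\<close> by at most \<open>\<bar>\<theta>\<bar>\<^sup>3 / 6\<close>. Summed over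
the eigenvalues, the exponents of \<open>\<Phi>(s)\<close> and of \<open>exp (- s\<^sup>2 / 2)\<close> differ by at most \<open>\<surd>2 a \<bar>s\<bar>\<^sup>3 / 3\<close>.
Moreover \<open>\<bar>\<Phi>(s)\<bar> = \<Prod>\<^sub>i (1 + s\<^sup>2 d\<^sub>i\<^sup>2)\<^sup>-\<^sup>1\<^sup>/\<^sup>4\<close> is at most what it would be if \<open>1 / a\<^sup>2\<close> of the \<open>d\<^sub>i\<close> had the
maximal modulus \<open>\<surd>2 a\<close> and the others were zero: by concavity of the logarithm \<open>\<bar>\<Phi>(s)\<bar> \<le> w(s)\<close>, where \<open>w(s)\<close> is
\<open>1 + 2 a\<^sup>2 s\<^sup>2\<close> raised to the power \<open>- 1 / (4 a\<^sup>2)\<close> (lemma \<open>standardized_quadratic_cf_bounds\<close>). The condition \<open>8 a\<^sup>2 < 1\<close> is exactly what makes \<open>\<bar>s\<bar>\<^sup>3 w(s)\<close>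
integrable, with integral \<open>4 / ((1 - 4 a\<^sup>2) (1 - 8 a\<^sup>2))\<close>, while \<open>\<bar>s\<bar>\<^sup>3 exp (- s\<^sup>2 / 2)\<close> has integral \<open>4\<close>.

Since \<open>\<Phi>\<close> is integrable, Fourier inversion (lemma \<open>continuous_density_of_integrable_char\<close>) provides a
continuous density, and the same inversion represents the standard normal density. The two densities
therefore differ by at most \<open>1 / (2 \<pi>)\<close> times the integral of \<open>\<bar>\<Phi>(s) - exp (- s\<^sup>2 / 2)\<bar>\<close>. The estimate
\<open>\<bar>exp p - exp q\<bar> \<le> \<bar>p - q\<bar> (\<bar>exp p\<bar> + \<bar>exp q\<bar>) / 2\<close>, which averages the two moduli where the mean value
bound would take the larger one, is sharp enough: the integral it leads to lies below the stated
constant (lemma \<open>integrated_bound_le_stated_constant\<close>).\<close>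

section \<open>Symmetric matrices: diagonalization and square roots\<close>

text \<open>A maximizer of the Rayleigh quotient on the unit sphere of \<open>V\<close>, which exists by compactness, is an
eigenvector.\<close>

lemma self_adjoint_eigenvector:
  fixes f :: "'a::euclidean_space \<Rightarrow> 'a"
  assumes lin: "linear f" and adj: "\<And>x y. f x \<bullet> y = x \<bullet> f y"
    and V: "subspace V" "f ` V \<subseteq> V" "V \<noteq> {0}"
  obtains x c where "x \<in> V" "norm x = 1" "f x = c *\<^sub>R x"
proof -
  interpret linear f by (rule lin)
  obtain z where z: "z \<in> V" "z \<noteq> 0"
    using V(1,3) subspace_0 by blast
  let ?S = "V \<inter> sphere 0 1"
  have "z /\<^sub>R norm z \<in> ?S"
    using z V(1) by (auto simp: subspace_mul)
  then have ne: "?S \<noteq> {}" by blast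
  have comp: "compact ?S"
    by (intro closed_Int_compact closed_subspace V compact_sphere)
  have contf: "continuous_on ?S f"
    by (rule linear_continuous_on_compose[OF continuous_on_id lin, unfolded comp_def id_def])
  have "continuous_on ?S (\<lambda>x. x \<bullet> f x)"
    by (intro continuous_on_inner continuous_on_id contf)
  from continuous_attains_sup[OF comp ne this]
  obtain x where x: "x \<in> ?S" and max: "\<And>y. y \<in> ?S \<Longrightarrow> y \<bullet> f y \<le> x \<bullet> f x"
    by blast
  define c where "c = x \<bullet> f x"
  have xx: "x \<bullet> x = 1" using x by (simp add: norm_eq_1)
  have quad: "y \<bullet> f y \<le> c * (y \<bullet> y)" if "y \<in> V" for y
  proof (cases "y = 0")
    case False
    have "(y /\<^sub>R norm y) \<bullet> f (y /\<^sub>R norm y) \<le> c"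
      unfolding c_def by (rule max) (use that False V(1) in \<open>auto simp: subspace_mul\<close>)
    then have "(y \<bullet> f y) / (norm y)\<^sup>2 \<le> c"
      by (simp add: scale power2_eq_square divide_simps)
    then show ?thesis
      using False by (simp add: divide_simps power2_norm_eq_inner split: if_splits)
  qed simp
  define w where "w = f x - c *\<^sub>R x"
  have wV: "w \<in> V"
    unfolding w_def using x V by (intro subspace_diff subspace_mul) auto
  have fw: "x \<bullet> f w = w \<bullet> f x" by (metis adj inner_commute)
  \<comment> \<open>\<open>x\<close> is a critical point: the first-order term of the Rayleigh quotient vanishes along \<open>w\<close>.\<close>
  have first: "2 * t * (w \<bullet> w) \<le> t\<^sup>2 * (c * (w \<bullet> w) - w \<bullet> f w)" for t
  proof -
    have "(x + t *\<^sub>R w) \<bullet> f (x + t *\<^sub>R w) \<le> c * ((x + t *\<^sub>R w) \<bullet> (x + t *\<^sub>R w))"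
      by (rule quad) (use x wV V in \<open>auto intro!: subspace_add subspace_mul\<close>)
    then have "c + 2 * t * (w \<bullet> f x) + t\<^sup>2 * (w \<bullet> f w) \<le> c * (1 + 2 * t * (w \<bullet> x) + t\<^sup>2 * (w \<bullet> w))"
      unfolding c_def[symmetric]
      by (simp add: add scale inner_add_left inner_add_right fw xx algebra_simps power2_eq_square
          c_def[symmetric] inner_commute[of x w])
    moreover have "w \<bullet> f x = w \<bullet> w + c * (w \<bullet> x)"
      by (simp add: w_def inner_diff_left inner_diff_right algebra_simps)
    ultimately show ?thesis by (simp add: algebra_simps)
  qed
  have "w \<bullet> w \<le> 0"
  proof (rule ccontr)
    assume "\<not> ?thesis"
    then have pos: "w \<bullet> w > 0" by (simp only: not_le)
    \<comment> \<open>any step \<open>t = (w \<bullet> w) / K\<close> with \<open>K\<close> above the second-order coefficient contradicts \<open>first\<close>\<close>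
    define K where "K = \<bar>c * (w \<bullet> w) - w \<bullet> f w\<bar> + 1"
    have K: "K > 0" "c * (w \<bullet> w) - w \<bullet> f w \<le> K" by (auto simp: K_def)
    have "2 * (w \<bullet> w / K) * (w \<bullet> w) \<le> (w \<bullet> w / K)\<^sup>2 * K"
      using first[of "w \<bullet> w / K"] K(2) by (meson mult_left_mono order_trans zero_le_power2)
    also have "\<dots> = (w \<bullet> w / K) * (w \<bullet> w)" using K by (simp add: power2_eq_square)
    finally have "2 * (w \<bullet> w / K) * (w \<bullet> w) \<le> (w \<bullet> w / K) * (w \<bullet> w)" .
    moreover have "0 < (w \<bullet> w / K) * (w \<bullet> w)" using pos K by (intro mult_pos_pos divide_pos_pos)
    ultimately show False by linarith
  qed
  then have "w = 0" by (metis antisym inner_ge_zero inner_eq_zero_iff)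
  then have "f x = c *\<^sub>R x" by (simp add: w_def)
  with x show ?thesis by (intro that[of x c]) auto
qed

text \<open>Split off one eigenvector; its orthogonal complement in \<open>V\<close> is again invariant because \<open>f\<close> is self-adjoint,
so induction on the dimension applies. The statement about subspaces is what the induction needs.\<close>

lemma self_adjoint_orthonormal_eigenbasis:
  fixes f :: "'a::euclidean_space \<Rightarrow> 'a"
  assumes lin: "linear f" and adj: "\<And>x y. f x \<bullet> y = x \<bullet> f y"
    and "subspace V" "f ` V \<subseteq> V"
  shows "\<exists>B\<subseteq>V. pairwise orthogonal B \<and> (\<forall>b\<in>B. norm b = 1 \<and> (\<exists>c. f b = c *\<^sub>R b)) \<and> span B = V"
  using assms(3,4)
proof (induction "dim V" arbitrary: V rule: less_induct)
  case less
  show ?case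
  proof (cases "V = {0}")
    case True
    then show ?thesis by (intro exI[of _ "{}"]) auto
  next
    case False
    obtain x c where x: "x \<in> V" "norm x = 1" "f x = c *\<^sub>R x"
      using self_adjoint_eigenvector[OF lin adj less.prems False] by blast
    have xx: "x \<bullet> x = 1" using x by (simp add: norm_eq_1)
    define W where "W = V \<inter> {y. x \<bullet> y = 0}"
    have W: "subspace W"
      unfolding W_def by (intro subspace_inter less.prems subspace_hyperplane)
    have inv: "f ` W \<subseteq> W"
    proof safe
      fix y assume "y \<in> W"
      moreover have "x \<bullet> f y = c * (x \<bullet> y)" by (metis adj x(3) inner_scaleR_left)
      ultimately show "f y \<in> W" using less.prems by (auto simp: W_def)
    qed
    have "x \<notin> W" using xx by (simp add: W_def)
    moreover have "W \<subseteq> V" by (simp add: W_def)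
    ultimately have "W \<subset> V" using x(1) by blast
    then have "dim W < dim V"
      by (metis W dim_psubset less.prems(1) span_eq_iff)
    from less.hyps[OF this W inv] obtain B where B: "B \<subseteq> W" "pairwise orthogonal B"
      "\<And>b. b \<in> B \<Longrightarrow> norm b = 1 \<and> (\<exists>c. f b = c *\<^sub>R b)" "span B = W" by blast
    have "v \<in> span (insert x B)" if "v \<in> V" for v
    proof -
      have "v - (x \<bullet> v) *\<^sub>R x \<in> W"
        using that x less.prems by (auto simp: W_def inner_diff_right xx intro!: subspace_diff subspace_mul)
      then show ?thesis
        unfolding span_insert B(4) by blast
    qed
    moreover have "span (insert x B) \<subseteq> V"
      using B(1) x less.prems by (intro span_minimal) (auto simp: W_def)
    ultimately have "span (insert x B) = V" by blast
    moreover have "pairwise orthogonal (insert x B)"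
      using B(1,2) by (auto simp: pairwise_insert orthogonal_def W_def inner_commute)
    ultimately show ?thesis
      using B x by (intro exI[of _ "insert x B"]) (auto simp: W_def)
  qed
qed

definition diag_mat :: "real ^ 'n \<Rightarrow> real ^ 'n ^ 'n" where
  "diag_mat d = (\<chi> i j. if i = j then d $ i else 0)"

lemma diag_mat_mul: "diag_mat d ** diag_mat e = diag_mat (\<chi> i. d $ i * e $ i)"
  by (auto simp: diag_mat_def matrix_matrix_mult_def vec_eq_iff if_distrib[of "\<lambda>x. x * _"] sum.delta cong: if_cong)

lemma transpose_diag_mat [simp]: "transpose (diag_mat d) = diag_mat d"
  by (auto simp: diag_mat_def transpose_def vec_eq_iff)

lemma trace_diag_mat: "trace (diag_mat d) = (\<Sum>i\<in>UNIV. d $ i)"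
  by (simp add: diag_mat_def trace_def)

lemma diag_mat_vec: "diag_mat d *v x = (\<chi> i. d $ i * x $ i)"
  by (simp add: diag_mat_def matrix_vector_mult_def vec_eq_iff if_distrib[of "\<lambda>x. x * _"] cong: if_cong)

lemma inner_diag_mat: "x \<bullet> (diag_mat d *v x) = (\<Sum>i\<in>UNIV. d $ i * (x $ i)\<^sup>2)"
  by (simp add: diag_mat_vec inner_vec_def power2_eq_square mult_ac)

lemma inner_symmetric_mat:
  fixes A :: "real ^ 'n ^ 'n"
  assumes "transpose A = A"
  shows "(A *v x) \<bullet> y = x \<bullet> (A *v y)"
  using assms by (metis dot_lmul_matrix vector_transpose_matrix)

theorem symmetric_matrix_diagonalization:
  fixes A :: "real ^ 'n ^ 'n"
  assumes sym: "transpose A = A"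
  obtains Q d where "orthogonal_matrix Q" "A = Q ** diag_mat d ** transpose Q"
proof -
  have "\<exists>B\<subseteq>UNIV. pairwise orthogonal B \<and>
      (\<forall>b\<in>B. norm b = 1 \<and> (\<exists>c. A *v b = c *\<^sub>R b)) \<and> span B = UNIV"
    by (rule self_adjoint_orthonormal_eigenbasis) (auto simp: inner_symmetric_mat[OF sym])
  then obtain B :: "(real ^ 'n) set" where B: "pairwise orthogonal B"
    "\<And>b. b \<in> B \<Longrightarrow> norm b = 1" "\<And>b. b \<in> B \<Longrightarrow> \<exists>c. A *v b = c *\<^sub>R b" "span B = UNIV" by blast
  have "0 \<notin> B" using B(2) by force
  then have "independent B" using B(1) by (rule pairwise_orthogonal_independent[rotated])
  then have "finite B" and "card B = CARD('n)"
    using B(4) by (simp_all add: independent_imp_finite flip: dim_eq_card_independent dim_span[of B])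
  then obtain e where e: "bij_betw e (UNIV :: 'n set) B"
    by (metis finite_same_card_bij finite)
  have eB: "e i \<in> B" for i using e by (auto simp: bij_betw_def)
  have eo: "e i \<bullet> e j = (if i = j then 1 else 0)" for i j
    using B(1) B(2)[OF eB[of i]] eB[of i] eB[of j] e
    by (auto simp: pairwise_def orthogonal_def norm_eq_1 bij_betw_def inj_on_def)
  obtain c where c: "\<And>i. A *v e i = c i *\<^sub>R e i"
    using B(3)[OF eB] by metis
  define Q where "Q = (\<chi> i j. e j $ i)"
  have Q: "transpose Q ** Q = mat 1"
    using eo by (simp add: Q_def transpose_def matrix_matrix_mult_def vec_eq_iff mat_def inner_vec_def)
  then have orth: "orthogonal_matrix Q" by (simp add: orthogonal_matrix)
  have "A ** Q = Q ** diag_mat (\<chi> i. c i)"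
  proof -
    have "(A ** Q) $ i $ j = (A *v e j) $ i" for i j
      by (simp add: matrix_matrix_mult_def Q_def matrix_vector_mult_def)
    then show ?thesis
      unfolding c
      by (simp add: vec_eq_iff matrix_matrix_mult_def Q_def diag_mat_def
            if_distrib[of "\<lambda>x. _ * x"] mult.commute cong: if_cong)
  qed
  then have "A ** Q ** transpose Q = Q ** diag_mat (\<chi> i. c i) ** transpose Q" by simp
  moreover have "A ** Q ** transpose Q = A"
    using orth by (simp add: orthogonal_matrix_def flip: matrix_mul_assoc)
  ultimately show ?thesis using that orth by metis
qed

lemma quadratic_form_diagonalized:
  fixes x :: "real ^ 'n"
  assumes "D = Q ** diag_mat d ** transpose Q"
  shows "x \<bullet> (D *v x) = (\<Sum>i\<in>UNIV. d $ i * ((transpose Q *v x) $ i)\<^sup>2)"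
  unfolding assms
  by (simp add: dot_lmul_matrix transpose_matrix_vector flip: matrix_vector_mul_assoc inner_diag_mat)

lemma diagonalization_eigenvector:
  fixes Q :: "real ^ 'n ^ 'n"
  assumes Q: "orthogonal_matrix Q" and D: "D = Q ** diag_mat d ** transpose Q"
  shows "D *v (Q *v axis i 1) = d $ i *\<^sub>R (Q *v axis i 1)" "norm (Q *v axis i 1) = 1"
proof -
  show "norm (Q *v axis i 1) = 1"
    using orthogonal_transformation_norm[OF orthogonal_transformation_matrix[THEN iffD2, of "(*v) Q"]] Q
    by simp
  have "D *v (Q *v axis i 1) = Q *v (diag_mat d *v ((transpose Q ** Q) *v axis i 1))"
    by (simp add: D matrix_vector_mul_assoc matrix_mul_assoc)
  also have "transpose Q ** Q = mat 1" using Q by (simp add: orthogonal_matrix_def)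
  also have "diag_mat d *v (mat 1 *v axis i 1) = d $ i *\<^sub>R axis i 1"
    by (auto simp: diag_mat_vec vec_eq_iff axis_def)
  finally show "D *v (Q *v axis i 1) = d $ i *\<^sub>R (Q *v axis i 1)"
    by (simp add: matrix_vector_mult_scaleR)
qed

lemma eigenvalue_le_spectral_norm:
  fixes Q :: "real ^ 'n ^ 'n"
  assumes Q: "orthogonal_matrix Q" and D: "D = Q ** diag_mat d ** transpose Q"
  shows "\<bar>d $ i\<bar> \<le> spectral_norm D"
proof -
  have "\<bar>d $ i\<bar> = norm (D *v (Q *v axis i 1))"
    using diagonalization_eigenvector[OF assms, of i] by simp
  also have "\<dots> \<le> spectral_norm D * norm (Q *v axis i 1)"
    unfolding spectral_norm_def by (rule onorm) (rule matrix_vector_mul_bounded_linear)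
  finally show ?thesis using diagonalization_eigenvector(2)[OF assms, of i] by simp
qed

lemma trace_symmetric_square:
  fixes A :: "real ^ 'n ^ 'n"
  assumes "transpose A = A"
  shows "trace (A ** A) = (norm A)\<^sup>2"
proof -
  have "A $ i $ j = A $ j $ i" for i j
    using assms by (metis transpose_def vec_lambda_beta)
  then have "trace (A ** A) = (\<Sum>i\<in>UNIV. \<Sum>j\<in>UNIV. (A $ i $ j)\<^sup>2)"
    by (simp add: trace_def matrix_matrix_mult_def power2_eq_square)
  then show ?thesis
    by (simp add: frobenius_norm_def sum_nonneg flip: frobenius_norm_eq_norm)
qed

text \<open>The Cauchy-Schwarz argument for the semi-inner product given by \<open>B\<close>.\<close>

lemma psd_inner_zeroD:
  assumes "psd B" "x \<bullet> (B *v x) = 0"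
  shows "B *v x = 0"
proof -
  have sym: "transpose B = B" and nn: "\<And>x. 0 \<le> x \<bullet> (B *v x)" using assms by (auto simp: psd_def)
  define y where "y = B *v x"
  define q where "q = y \<bullet> (B *v y)"
  \<comment> \<open>otherwise the form would be negative at \<open>x - t y\<close> for small positive \<open>t\<close>\<close>
  have "0 \<le> - 2 * t * (y \<bullet> y) + t\<^sup>2 * q" for t
  proof -
    have "x \<bullet> (B *v y) = y \<bullet> y" by (metis inner_symmetric_mat[OF sym] y_def)
    moreover have "0 \<le> (x - t *\<^sub>R y) \<bullet> (B *v (x - t *\<^sub>R y))" by (rule nn)
    ultimately show ?thesis
      using assms(2)
      by (simp add: matrix_vector_mult_diff_distrib matrix_vector_mult_scaleR inner_diff_left
            inner_diff_right q_def algebra_simps power2_eq_square flip: y_def)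
  qed
  note neg = this
  have q: "q \<ge> 0" unfolding q_def by (rule nn)
  define t where "t = (y \<bullet> y) / (q + 1)"
  have yy: "y \<bullet> y = t * (q + 1)" using q by (simp add: t_def)
  have "0 \<le> - (t\<^sup>2 * (q + 2))"
    using neg[of t] unfolding yy by (simp add: algebra_simps power2_eq_square)
  moreover have "0 \<le> t\<^sup>2 * (q + 2)" using q by (intro mult_nonneg_nonneg) auto
  ultimately have "t\<^sup>2 * (q + 2) = 0" by linarith
  with q have "t = 0" by auto
  with yy have "y = 0" by simp
  then show ?thesis by (simp add: y_def)
qed

text \<open>If \<open>D = B - C\<close> had an eigenvector \<open>x\<close> for a nonzero eigenvalue, then \<open>B D + D C = B\<^sup>2 - C\<^sup>2 = 0\<close> would
force both forms to vanish at \<open>x\<close>, hence \<open>B x = C x = 0\<close> and \<open>D x = 0\<close>.\<close>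

lemma psd_sqrt_unique:
  fixes B C :: "real ^ 'n ^ 'n"
  assumes B: "psd B" and C: "psd C" and eq: "B ** B = C ** C"
  shows "B = C"
proof -
  have sB: "transpose B = B" and sC: "transpose C = C" using B C by (auto simp: psd_def)
  define D where "D = B - C"
  have sD: "transpose D = D" using sB sC by (simp add: D_def transpose_def vec_eq_iff)
  obtain Q d where Q: "orthogonal_matrix Q" and D: "D = Q ** diag_mat d ** transpose Q"
    using symmetric_matrix_diagonalization[OF sD] by blast
  have "d $ i = 0" for i
  proof (rule ccontr)
    assume nz: "d $ i \<noteq> 0"
    define x where "x = Q *v axis i 1"
    have Dx: "D *v x = d $ i *\<^sub>R x" and "norm x = 1"
      using diagonalization_eigenvector[OF Q D, of i] by (simp_all add: x_def)
    then have x0: "x \<noteq> 0" by auto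
    \<comment> \<open>\<open>B D + D C = B\<^sup>2 - C\<^sup>2 = 0\<close>, tested at the eigenvector \<open>x\<close> of \<open>D\<close>\<close>
    have "B *v (D *v x) + D *v (C *v x) = 0"
    proof -
      have "B *v (B *v x) = C *v (C *v x)" by (simp add: matrix_vector_mul_assoc eq)
      then show ?thesis
        by (simp add: D_def matrix_vector_mult_diff_distrib matrix_vector_mult_diff_rdistrib)
    qed
    then have "x \<bullet> (B *v (D *v x)) + x \<bullet> (D *v (C *v x)) = 0"
      by (metis inner_add_right inner_zero_right)
    moreover have "x \<bullet> (D *v (C *v x)) = d $ i * (x \<bullet> (C *v x))"
      by (metis Dx inner_symmetric_mat[OF sD] inner_scaleR_left)
    ultimately have "d $ i * (x \<bullet> (B *v x) + x \<bullet> (C *v x)) = 0"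
      by (simp add: Dx matrix_vector_mult_scaleR algebra_simps)
    then have "x \<bullet> (B *v x) + x \<bullet> (C *v x) = 0" using nz by simp
    moreover have "0 \<le> x \<bullet> (B *v x)" "0 \<le> x \<bullet> (C *v x)" using B C by (auto simp: psd_def)
    ultimately have "x \<bullet> (B *v x) = 0" "x \<bullet> (C *v x) = 0" by linarith+
    then have "B *v x = 0" "C *v x = 0"
      using psd_inner_zeroD B C by blast+
    then have "D *v x = 0"
      by (simp add: D_def matrix_vector_mult_diff_rdistrib)
    with Dx nz x0 show False by simp
  qed
  then have "diag_mat d = 0" by (simp add: diag_mat_def vec_eq_iff)
  then show ?thesis using D by (simp add: D_def)
qed

lemma psd_sqrt_exists:
  fixes A :: "real ^ 'n ^ 'n"
  assumes "psd A"
  shows "\<exists>B. psd B \<and> B ** B = A"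
proof -
  have sA: "transpose A = A" using assms by (auto simp: psd_def)
  obtain Q d where Q: "orthogonal_matrix Q" and A: "A = Q ** diag_mat d ** transpose Q"
    using symmetric_matrix_diagonalization[OF sA] by blast
  have QQ: "transpose Q ** Q = mat 1" using Q by (simp add: orthogonal_matrix_def)
  note form = quadratic_form_diagonalized[OF refl, of _ Q]
  have d: "0 \<le> d $ i" for i
  proof -
    have "0 \<le> (Q *v axis i 1) \<bullet> (A *v (Q *v axis i 1))" using assms by (simp add: psd_def)
    also have "\<dots> = (\<Sum>j\<in>UNIV. d $ j * ((axis i 1 :: real ^ 'n) $ j)\<^sup>2)"
      unfolding A form by (simp add: matrix_vector_mul_assoc QQ)
    also have "\<dots> = (\<Sum>j\<in>UNIV. if i = j then d $ j else 0)"
      by (rule sum.cong) (auto simp: axis_def)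
    finally show ?thesis by simp
  qed
  define B where "B = Q ** diag_mat (\<chi> i. sqrt (d $ i)) ** transpose Q"
  have "B ** B = Q ** (diag_mat (\<chi> i. sqrt (d $ i)) ** (transpose Q ** Q) ** diag_mat (\<chi> i. sqrt (d $ i))) ** transpose Q"
    by (simp add: B_def matrix_mul_assoc)
  also have "\<dots> = A" using d by (simp add: A QQ diag_mat_mul)
  finally have "B ** B = A" .
  moreover have "psd B"
    unfolding psd_def B_def form
    using d by (auto simp: matrix_transpose_mul matrix_mul_assoc intro!: sum_nonneg)
  ultimately show ?thesis by blast
qed

text \<open>Existence and uniqueness make the definite description in \<^const>\<open>msqrt\<close> meaningful.\<close>

lemma msqrt_psd:
  assumes "psd A"
  shows "psd (msqrt A)" "msqrt A ** msqrt A = A"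
proof -
  have "\<exists>!B. psd B \<and> B ** B = A"
    using psd_sqrt_exists[OF assms] psd_sqrt_unique by metis
  from theI'[OF this] show "psd (msqrt A)" "msqrt A ** msqrt A = A"
    by (auto simp: msqrt_def)
qed

lemma matrix_inv_inverse:
  fixes A :: "real ^ 'n ^ 'n"
  assumes "invertible A"
  shows "A ** matrix_inv A = mat 1" "matrix_inv A ** A = mat 1"
  using someI_ex[OF assms[unfolded invertible_def]] by (auto simp: matrix_inv_def)

lemma inv_msqrt_pos_def:
  fixes A :: "real ^ 'n ^ 'n"
  assumes sym: "transpose A = A" and pos: "\<And>x. x \<noteq> 0 \<Longrightarrow> 0 < x \<bullet> (A *v x)"
  defines "K \<equiv> inv_msqrt A"
  shows "transpose K = K" "invertible K" "K ** A ** K = mat 1" "matrix_inv A = K ** K"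
proof -
  have psd: "psd A"
    unfolding psd_def using sym pos by (metis inner_zero_left less_eq_real_def)
  define B where "B = msqrt A"
  have B: "psd B" "B ** B = A" using msqrt_psd[OF psd] by (auto simp: B_def)
  have sB: "transpose B = B" using B by (simp add: psd_def)
  have "invertible A"
    using pos by (metis inner_zero_right less_irrefl matrix_left_invertible_ker invertible_left_inverse)
  then have "invertible B"
    using B(2) by (metis det_mul invertible_det_nz mult_eq_0_iff)
  then have inv: "B ** K = mat 1" "K ** B = mat 1"
    unfolding K_def inv_msqrt_def B_def[symmetric] by (simp_all add: matrix_inv_inverse)
  then show iK: "invertible K" unfolding invertible_def by blast
  show sK: "transpose K = K"
  proof -
    have "transpose K ** B = mat 1"
      using inv(1) sB by (metis matrix_transpose_mul transpose_mat)
    then have "transpose K ** B ** K = K" by simp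
    then show ?thesis using inv(1) by (simp flip: matrix_mul_assoc)
  qed
  have KBBK: "K ** A ** K = (K ** B) ** (B ** K)"
    by (simp add: matrix_mul_assoc flip: B(2))
  then show "K ** A ** K = mat 1" by (simp add: inv)
  have 1: "A ** (K ** K) = mat 1"
  proof -
    have "A ** (K ** K) = B ** (B ** K) ** K" by (simp add: matrix_mul_assoc flip: B(2))
    then show ?thesis by (simp add: inv)
  qed
  show "matrix_inv A = K ** K"
  proof -
    have "matrix_inv A ** A = mat 1" using \<open>invertible A\<close> by (simp add: matrix_inv_inverse)
    then have "matrix_inv A ** A ** (K ** K) = K ** K" by simp
    then show ?thesis using 1 by (simp flip: matrix_mul_assoc)
  qed
qed

section \<open>Fourier inversion for integrable characteristic functions\<close>

lemma has_vector_derivative_iff_difference_quotient: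
  fixes f :: "real \<Rightarrow> 'a::real_normed_vector"
  shows "(f has_vector_derivative D) (at x) \<longleftrightarrow> ((\<lambda>y. (f y - f x) /\<^sub>R (y - x)) \<longlongrightarrow> D) (at x)"
proof -
  have "norm ((f y - f x) - (y - x) *\<^sub>R D) / norm (y - x) = norm ((f y - f x) /\<^sub>R (y - x) - D)" if "y \<noteq> x" for y
  proof -
    have "(f y - f x) /\<^sub>R (y - x) - D = ((f y - f x) - (y - x) *\<^sub>R D) /\<^sub>R (y - x)"
      using that by (simp add: scaleR_diff_right)
    then show ?thesis by (simp add: divide_inverse mult.commute)
  qed
  then have "((\<lambda>y. norm ((f y - f x) - (y - x) *\<^sub>R D) / norm (y - x)) \<longlongrightarrow> 0) (at x) \<longleftrightarrow>
      ((\<lambda>y. norm ((f y - f x) /\<^sub>R (y - x) - D)) \<longlongrightarrow> 0) (at x)"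
    by (intro filterlim_cong refl) (auto simp: eventually_at_filter)
  then show ?thesis
    unfolding has_vector_derivative_def has_derivative_iff_norm
    by (simp add: bounded_linear_scaleR_left tendsto_norm_zero_iff LIM_zero_iff)
qed

definition inverse_fourier :: "(real \<Rightarrow> complex) \<Rightarrow> real \<Rightarrow> complex" where
  "inverse_fourier \<phi> x = (CLBINT t. iexp (- (t * x)) * \<phi> t) / (2 * pi)"

lemma integrable_iexp_mult:
  assumes "integrable lborel \<phi>" and [measurable]: "f \<in> borel_measurable borel"
  shows "integrable lborel (\<lambda>t. iexp (f t) * \<phi> t)"
  by (rule Bochner_Integration.integrable_bound[OF assms(1)])
    (use assms in \<open>auto simp: norm_mult\<close>)

lemma isCont_inverse_fourier:
  assumes int: "integrable lborel \<phi>"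
  shows "isCont (inverse_fourier \<phi>) x"
proof -
  have [measurable]: "\<phi> \<in> borel_measurable borel" using int by auto
  have "(\<lambda>n. CLBINT t. iexp (- (t * X n)) * \<phi> t) \<longlonglongrightarrow> (CLBINT t. iexp (- (t * x)) * \<phi> t)"
    if X: "X \<longlonglongrightarrow> x" for X
  proof (rule integral_dominated_convergence[where w = "\<lambda>t. norm (\<phi> t)"])
    show "AE t in lborel. (\<lambda>n. iexp (- (t * X n)) * \<phi> t) \<longlonglongrightarrow> iexp (- (t * x)) * \<phi> t"
      using X by (intro AE_I2 tendsto_intros)
  qed (use int in \<open>auto simp: norm_mult\<close>)
  then show ?thesis
    unfolding continuous_at_sequentially comp_def inverse_fourier_def
    by (auto intro!: tendsto_intros)
qed

text \<open>The factor of the characteristic function in Levy's inversion formula for the interval from \<open>a\<close> to \<open>b\<close>.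
It is the signed integral of \<open>exp (- i t x)\<close> over \<open>x\<close> from \<open>a\<close> to \<open>b\<close>; only at \<open>t = 0\<close> does division by zero give the
value \<open>0\<close> instead, which is invisible to integrals.\<close>

definition levy_kernel :: "real \<Rightarrow> real \<Rightarrow> real \<Rightarrow> complex" where
  "levy_kernel a b t = (iexp (- (t * a)) - iexp (- (t * b))) / (\<i> * t)"

lemma levy_kernel_measurable [measurable]: "levy_kernel a b \<in> borel_measurable borel"
  unfolding levy_kernel_def by measurable

lemma norm_levy_kernel:
  assumes "t \<noteq> 0"
  shows "norm (levy_kernel a b t) \<le> \<bar>b - a\<bar>"
proof (cases "a \<le> b")
  case True
  then show ?thesis
    using Levy_Inversion_aux2[of "- b" "- a" t] assms by (simp add: levy_kernel_def)
next
  case False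
  then show ?thesis
    using Levy_Inversion_aux2[of "- a" "- b" t] assms
    by (simp add: levy_kernel_def norm_divide norm_minus_commute)
qed

context real_distribution
begin

lemma integrable_levy_kernel:
  assumes "integrable lborel (char M)"
  shows "integrable lborel (\<lambda>t. levy_kernel a b t * char M t)"
proof (rule Bochner_Integration.integrable_bound)
  show "integrable lborel (\<lambda>t. \<bar>b - a\<bar> * norm (char M t))" using assms by simp
  have "norm (levy_kernel a b t * char M t) \<le> norm (\<bar>b - a\<bar> * norm (char M t))" if "t \<noteq> 0" for t
    using mult_right_mono[OF norm_levy_kernel[OF that], of "norm (char M t)" a b] by (simp add: norm_mult)
  then show "AE t in lborel. norm (levy_kernel a b t * char M t) \<le> norm (\<bar>b - a\<bar> * norm (char M t))"
    by (rule eventually_mono[OF AE_lborel_singleton[of 0]])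
qed measurable

text \<open>Integrability turns the truncated integrals of Levy's theorem into a Lebesgue integral by dominated
convergence.\<close>

lemma measure_Ioc_integrable_char:
  assumes int: "integrable lborel (char M)"
    and "a \<le> b" "measure M {a} = 0" "measure M {b} = 0"
  shows "complex_of_real (measure M {a<..b}) = (CLBINT t. levy_kernel a b t * char M t) / (2 * pi)"
proof (rule LIMSEQ_unique)
  let ?f = "\<lambda>t. levy_kernel a b t * char M t"
  show "(\<lambda>T::nat. 1 / (2 * pi) * (CLBINT t=-T..T. ?f t)) \<longlonglongrightarrow> complex_of_real (measure M {a<..b})"
    unfolding levy_kernel_def using Levy_Inversion[OF assms(2-)] .
  have "(\<lambda>T::nat. CLBINT t. indicator {- real T<..<real T} t *\<^sub>R ?f t) \<longlonglongrightarrow> (CLBINT t. ?f t)"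
  proof (rule integral_dominated_convergence[where w = "\<lambda>t. norm (?f t)"])
    show "AE t in lborel. (\<lambda>T::nat. indicator {- real T<..<real T} t *\<^sub>R ?f t) \<longlonglongrightarrow> ?f t"
    proof (rule AE_I2)
      fix t :: real
      obtain N :: nat where N: "\<bar>t\<bar> < N" using reals_Archimedean2 by blast
      show "(\<lambda>T::nat. indicator {- real T<..<real T} t *\<^sub>R ?f t) \<longlonglongrightarrow> ?f t"
        by (rule tendsto_eventually, rule eventually_sequentiallyI[of N]) (use N in \<open>auto simp: indicator_def\<close>)
    qed
  qed (use integrable_levy_kernel[OF int, of a b] in \<open>auto split: split_indicator\<close>)
  moreover have "(CLBINT t=-T..T. ?f t) = (CLBINT t. indicator {- real T<..<real T} t *\<^sub>R ?f t)" for T :: nat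
    by (simp add: interval_lebesgue_integral_def set_lebesgue_integral_def)
  ultimately have "(\<lambda>T::nat. CLBINT t=-T..T. ?f t) \<longlonglongrightarrow> (CLBINT t. ?f t)" by simp
  from tendsto_mult[OF tendsto_const this, of "1 / (2 * complex_of_real pi)"]
  show "(\<lambda>T::nat. 1 / (2 * pi) * (CLBINT t=-T..T. ?f t)) \<longlonglongrightarrow> (CLBINT t. ?f t) / (2 * pi)" by simp
qed

lemma levy_kernel_integral_diff:
  assumes int: "integrable lborel (char M)"
  shows "(CLBINT t. levy_kernel c y t * char M t) - (CLBINT t. levy_kernel c x t * char M t)
     = (CLBINT t. levy_kernel x y t * char M t)"
proof -
  have "levy_kernel c y t * char M t - levy_kernel c x t * char M t = levy_kernel x y t * char M t" for t
    by (simp add: levy_kernel_def diff_divide_distrib algebra_simps)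
  then show ?thesis
    using Bochner_Integration.integral_diff[OF integrable_levy_kernel[OF int, of c y] integrable_levy_kernel[OF int, of c x]]
    by simp
qed

text \<open>Differentiation under the integral sign; the difference quotients of the kernel are bounded by \<open>1\<close>.\<close>

lemma levy_kernel_primitive:
  assumes int: "integrable lborel (char M)"
  shows "((\<lambda>x. (CLBINT t. levy_kernel c x t * char M t) / (2 * pi))
           has_vector_derivative inverse_fourier (char M) x) (at x)"
proof -
  define \<Gamma> where "\<Gamma> x = (CLBINT t. levy_kernel c x t * char M t)" for x
  have add: "\<Gamma> y - \<Gamma> x = (CLBINT t. levy_kernel x y t * char M t)" for x y
    unfolding \<Gamma>_def
    using levy_kernel_integral_diff[OF int] .
  have "((\<lambda>y. (\<Gamma> y - \<Gamma> x) /\<^sub>R (y - x)) \<longlongrightarrow> (CLBINT t. iexp (- (t * x)) * char M t)) (at x)"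
    unfolding tendsto_at_iff_sequentially comp_def
  proof (intro allI impI)
    fix X :: "nat \<Rightarrow> real" assume neq: "\<forall>i. X i \<in> UNIV - {x}" and X: "X \<longlonglongrightarrow> x"
    let ?s = "\<lambda>n t. (levy_kernel x (X n) t * char M t) /\<^sub>R (X n - x)"
    have "(\<lambda>n. CLBINT t. ?s n t) \<longlonglongrightarrow> (CLBINT t. iexp (- (t * x)) * char M t)"
    proof (rule integral_dominated_convergence[where w = "\<lambda>t. norm (char M t)"])
      have "norm (?s n t) \<le> norm (char M t)" if "t \<noteq> 0" for n t
      proof -
        have "norm (levy_kernel x (X n) t) / \<bar>X n - x\<bar> \<le> 1"
          using norm_levy_kernel[OF that, of x "X n"] neq by (simp add: divide_le_eq_1)
        from mult_right_mono[OF this, of "norm (char M t)"] show ?thesis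
          by (simp add: norm_mult divide_inverse mult_ac)
      qed
      then show "AE t in lborel. norm (?s n t) \<le> norm (char M t)" for n
        by (rule eventually_mono[OF AE_lborel_singleton[of 0]])
      have "(\<lambda>n. ?s n t) \<longlonglongrightarrow> iexp (- (t * x)) * char M t" if t: "t \<noteq> 0" for t
      proof -
        have "((\<lambda>z. exp (\<i> * (- (t * z)))) has_field_derivative - (\<i> * t) * iexp (- (t * x))) (at (complex_of_real x))"
          by (auto intro!: derivative_eq_intros)
        from has_vector_derivative_real_field[OF this]
        have "((\<lambda>y. iexp (- (t * y))) has_vector_derivative (- (\<i> * t) * iexp (- (t * x)))) (at x)"
          by simp
        then have "((\<lambda>y. (iexp (- (t * y)) - iexp (- (t * x))) /\<^sub>R (y - x)) \<longlongrightarrow> - (\<i> * t) * iexp (- (t * x))) (at x)"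
          by (simp only: has_vector_derivative_iff_difference_quotient)
        then have "(\<lambda>n. (iexp (- (t * X n)) - iexp (- (t * x))) /\<^sub>R (X n - x)) \<longlonglongrightarrow> - (\<i> * t) * iexp (- (t * x))"
          using neq X unfolding tendsto_at_iff_sequentially comp_def by blast
        then have "(\<lambda>n. (iexp (- (t * X n)) - iexp (- (t * x))) /\<^sub>R (X n - x) * (- char M t / (\<i> * t)))
            \<longlonglongrightarrow> - (\<i> * t) * iexp (- (t * x)) * (- char M t / (\<i> * t))"
          by (intro tendsto_mult tendsto_const)
        moreover have "- (\<i> * t) * iexp (- (t * x)) * (- char M t / (\<i> * t)) = iexp (- (t * x)) * char M t"
          using t by simp
        moreover have "(iexp (- (t * X n)) - iexp (- (t * x))) /\<^sub>R (X n - x) * (- char M t / (\<i> * t)) = ?s n t" for n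
          by (simp add: levy_kernel_def scaleR_conv_of_real divide_simps) (simp add: algebra_simps)
        ultimately show ?thesis by simp
      qed
      then show "AE t in lborel. (\<lambda>n. ?s n t) \<longlonglongrightarrow> iexp (- (t * x)) * char M t"
        by (rule eventually_mono[OF AE_lborel_singleton[of 0]])
    qed (use int in auto)
    then show "(\<lambda>n. (\<Gamma> (X n) - \<Gamma> x) /\<^sub>R (X n - x)) \<longlonglongrightarrow> (CLBINT t. iexp (- (t * x)) * char M t)"
      by (simp add: add)
  qed
  then have "(\<Gamma> has_vector_derivative (CLBINT t. iexp (- (t * x)) * char M t)) (at x)"
    by (simp only: has_vector_derivative_iff_difference_quotient)
  then show ?thesis
    unfolding \<Gamma>_def inverse_fourier_def by (rule has_vector_derivative_divide)
qed

text \<open>The inversion formula identifies the increments of the distribution function with those of a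
differentiable function \<open>G\<close>, but only between points that carry no mass. Those points are co-countable, hence
dense, and right continuity extends the identity to all points.\<close>

lemma cdf_has_derivative_inverse_fourier:
  assumes int: "integrable lborel (char M)"
  shows "(cdf M has_real_derivative Re (inverse_fourier (char M) x)) (at x)"
proof -
  define G where "G x = Re ((CLBINT t. levy_kernel 0 x t * char M t) / (2 * pi))" for x
  have G: "(G has_real_derivative Re (inverse_fourier (char M) x)) (at x)" for x
    using levy_kernel_primitive[OF int, of 0 x]
    unfolding G_def has_real_derivative_iff_has_vector_derivative
    by (rule bounded_linear.has_vector_derivative[OF bounded_linear_Re])
  define S where "S = {x. measure M {x} \<noteq> 0}"
  have S: "countable S" unfolding S_def by (rule countable_support)
  have incr: "cdf M b - cdf M a = G b - G a" if "a \<notin> S" "b \<notin> S" "a < b" for a b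
  proof -
    have "G b - G a = Re ((CLBINT t. levy_kernel a b t * char M t) / (2 * pi))"
      unfolding levy_kernel_integral_diff[OF int, of 0 b a, symmetric] by (simp add: G_def diff_divide_distrib)
    also have "\<dots> = measure M {a<..b}"
      using that by (subst measure_Ioc_integrable_char[OF int, symmetric]) (auto simp: S_def)
    finally show ?thesis using cdf_diff_eq[OF that(3)] by simp
  qed
  \<comment> \<open>a reference point at which the integration constant is read off\<close>
  obtain s0 where s0: "s0 \<notin> S"
    using S uncountable_UNIV_real by (metis UNIV_I countable_subset subsetI)
  have const: "cdf M s - G s = cdf M s0 - G s0" if "s \<notin> S" for s
    using incr[of s s0] incr[of s0 s] s0 that by (cases s s0 rule: linorder_cases) auto
  have "cdf M x - G x = cdf M s0 - G s0" for x
  proof -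
    have "\<exists>s. s \<notin> S \<and> x < s \<and> s < x + 1 / real (Suc n)" for n
      using open_minus_countable[OF S, of "{x<..<x + 1 / real (Suc n)}"] by (auto simp: ex_in_conv)
    then obtain s where s: "\<And>n. s n \<notin> S" "\<And>n. x < s n" "\<And>n. s n < x + 1 / real (Suc n)"
      by metis
    have sx: "s \<longlonglongrightarrow> x"
    proof (rule tendsto_sandwich[of "\<lambda>_. x" s _ "\<lambda>n. x + 1 / real (Suc n)"])
      show "(\<lambda>n. x + 1 / real (Suc n)) \<longlonglongrightarrow> x"
        using LIMSEQ_inverse_real_of_nat_add[of x] by (simp add: inverse_eq_divide)
      show "\<forall>\<^sub>F n in sequentially. x \<le> s n" "\<forall>\<^sub>F n in sequentially. s n \<le> x + 1 / real (Suc n)"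
        using s(2,3) by (simp_all add: less_imp_le del: of_nat_Suc)
    qed simp
    have "filterlim s (at_right x) sequentially"
    proof -
      have "s n \<in> {x<..} \<and> s n \<noteq> x" for n using s(2)[of n] by auto
      then show ?thesis using sx by (simp add: filterlim_at)
    qed
    moreover have "((\<lambda>y. cdf M y - G y) \<longlongrightarrow> cdf M x - G x) (at_right x)"
      using cdf_is_right_cont[of x] DERIV_isCont[OF G[of x]]
      by (intro tendsto_diff) (auto simp: continuous_within isCont_def intro: tendsto_within_subset)
    ultimately have "(\<lambda>n. cdf M (s n) - G (s n)) \<longlonglongrightarrow> cdf M x - G x"
      by (rule filterlim_compose[rotated])
    then show ?thesis using const s(1) by (simp add: LIMSEQ_const_iff)
  qed
  then have "cdf M = (\<lambda>x. G x + (cdf M s0 - G s0))" by (auto simp: algebra_simps)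
  with DERIV_add[OF G[of x] DERIV_const[of "cdf M s0 - G s0"]] show ?thesis by (simp only: add_0_right)
qed

text \<open>The inverse transform is the derivative of a monotone function.\<close>

lemma Re_inverse_fourier_nonneg:
  assumes "integrable lborel (char M)"
  shows "0 \<le> Re (inverse_fourier (char M) x)"
  by (rule mono_on_imp_deriv_nonneg[OF _ cdf_has_derivative_inverse_fourier[OF assms], of UNIV])
    (auto simp: mono_on_def cdf_nondecreasing)

lemma density_of_integrable_char:
  assumes int: "integrable lborel (char M)"
  shows "M = density lborel (\<lambda>x. ennreal (Re (inverse_fourier (char M) x)))" (is "_ = density _ ?g")
proof -
  let ?h = "\<lambda>x. Re (inverse_fourier (char M) x)"
  have [measurable]: "?h \<in> borel_measurable borel"
    by (intro borel_measurable_continuous_onI continuous_at_imp_continuous_on ballI continuous_Re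
        isCont_inverse_fourier int)
  have eq: "emeasure (density lborel ?g) {a<..b} = ennreal (cdf M b - cdf M a)" if "a \<le> b" for a b
  proof -
    have "emeasure (density lborel ?g) {a<..b} = (\<integral>\<^sup>+x. ?g x * indicator {a<..b} x \<partial>lborel)"
      by (simp add: emeasure_density)
    also have "\<dots> = (\<integral>\<^sup>+x. ?g x * indicator {a..b} x \<partial>lborel)"
      using AE_lborel_singleton[of a]
      by (intro nn_integral_cong_AE, eventually_elim) (auto split: split_indicator)
    also have "\<dots> = ennreal (cdf M b - cdf M a)"
      by (rule nn_integral_FTC_Icc)
        (auto intro: cdf_has_derivative_inverse_fourier Re_inverse_fourier_nonneg int that)
    finally show ?thesis .
  qed
  show ?thesis
  proof (rule measure_eqI_generator_eq[where \<Omega>=UNIV and E="range (\<lambda>(a, b). {a<..b::real})"])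
    fix X assume "X \<in> range (\<lambda>(a, b). {a<..b::real})"
    then obtain a b where Xeq: "X = {a<..b}" by auto
    then show "emeasure M X = emeasure (density lborel ?g) X"
      by (cases "a \<le> b") (simp_all add: emeasure_Ioc eq)
  next
    show "(\<Union>i. {- real (i::nat)<..real i}) = UNIV"
      by (rule UN_Ioc_eq_UNIV)
  qed (auto simp: emeasure_Ioc borel_sigma_sets_Ioc Int_stable_def)
qed

end

lemma (in prob_space) continuous_density_of_integrable_char:
  assumes [measurable]: "X \<in> borel_measurable M" and int: "integrable lborel (char (distr M borel X))"
  shows "continuous_density M X (\<lambda>x. Re (inverse_fourier (char (distr M borel X)) x))"
proof -
  interpret D: real_distribution "distr M borel X" by simp
  have "continuous_on UNIV (\<lambda>x. Re (inverse_fourier (char (distr M borel X)) x))"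
    by (intro continuous_at_imp_continuous_on ballI continuous_Re isCont_inverse_fourier int)
  moreover from this have "(\<lambda>x. Re (inverse_fourier (char (distr M borel X)) x)) \<in> borel_measurable borel"
    by (rule borel_measurable_continuous_onI)
  ultimately show ?thesis
    using D.density_of_integrable_char[OF int] D.Re_inverse_fourier_nonneg[OF int]
    unfolding continuous_density_def distributed_def by (auto cong: distr_cong)
qed

lemma std_normal_cf_integrable: "integrable lborel (\<lambda>t. complex_of_real (exp (- t\<^sup>2 / 2)))"
proof -
  have "integrable lborel (\<lambda>t. sqrt (2 * pi) * std_normal_density t)"
    by simp
  then have "integrable lborel (\<lambda>t::real. exp (- t\<^sup>2 / 2))"
    by (simp add: std_normal_density_def)
  then show ?thesis unfolding complex_of_real_integrable_eq .
qed

text \<open>The standard normal density is itself a continuous density, so it must agree with the one that inversion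
of \<open>exp (- t\<^sup>2 / 2)\<close> yields.\<close>

lemma std_normal_inverse_fourier:
  "std_normal_density x = Re (inverse_fourier (\<lambda>t. complex_of_real (exp (- t\<^sup>2 / 2))) x)"
proof -
  interpret N: real_distribution std_normal_distribution by (rule real_dist_normal_dist)
  have id: "distr std_normal_distribution borel (\<lambda>x. x) = std_normal_distribution"
    by (rule distr_id2) simp
  have int: "integrable lborel (char std_normal_distribution)"
    unfolding char_std_normal_distribution by (rule std_normal_cf_integrable)
  have "continuous_density std_normal_distribution (\<lambda>x. x) (\<lambda>x. Re (inverse_fourier (char std_normal_distribution) x))"
    using N.continuous_density_of_integrable_char[of "\<lambda>x. x"] int unfolding id by simp
  moreover have "distr std_normal_distribution lborel (\<lambda>x. x) = std_normal_distribution"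
    by (rule distr_id2) simp
  then have "continuous_density std_normal_distribution (\<lambda>x. x) std_normal_density"
    unfolding continuous_density_def distributed_def
    by (auto simp: std_normal_density_def[abs_def] intro!: continuous_intros)
  ultimately show ?thesis
    unfolding char_std_normal_distribution by (metis continuous_density_unique)
qed

lemma inverse_fourier_diff_bound:
  assumes "integrable lborel \<phi>" "integrable lborel \<phi>'"
    and w: "has_bochner_integral lborel w I" and le: "\<And>t. norm (\<phi> t - \<phi>' t) \<le> w t"
  shows "\<bar>Re (inverse_fourier \<phi> x) - Re (inverse_fourier \<phi>' x)\<bar> \<le> 1 / (2 * pi) * I"
proof -
  have "inverse_fourier \<phi> x - inverse_fourier \<phi>' x = (CLBINT t. iexp (- (t * x)) * (\<phi> t - \<phi>' t)) / (2 * pi)"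
    unfolding inverse_fourier_def right_diff_distrib
    by (subst Bochner_Integration.integral_diff[OF integrable_iexp_mult[OF assms(1)] integrable_iexp_mult[OF assms(2)]])
      (auto simp: diff_divide_distrib)
  moreover have "norm (CLBINT t. iexp (- (t * x)) * (\<phi> t - \<phi>' t)) \<le> (LBINT t. w t)"
    by (rule order_trans[OF integral_norm_bound], rule integral_mono)
      (use assms in \<open>auto simp: norm_mult has_bochner_integral_iff intro!: integrable_iexp_mult integrable_norm\<close>)
  moreover have "(LBINT t. w t) = I" using w by (simp add: has_bochner_integral_iff)
  ultimately have "norm (inverse_fourier \<phi> x - inverse_fourier \<phi>' x) \<le> 1 / (2 * pi) * I"
    by (simp add: norm_divide divide_right_mono)
  then show ?thesis
    using abs_Re_le_cmod[of "inverse_fourier \<phi> x - inverse_fourier \<phi>' x"] by simp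
qed

section \<open>Estimates for the characteristic function of a standardized quadratic form\<close>

text \<open>The logarithm of the characteristic function of \<open>(X\<^sup>2 - 1) / 2\<close> for a standard normal \<open>X\<close>; see
\<open>std_normal_centred_half_square_cf\<close>.\<close>

definition log_cf :: "real \<Rightarrow> complex" where
  "log_cf \<theta> = - (\<i> * \<theta>) / 2 - Ln (1 - \<i> * \<theta>) / 2"

lemma one_minus_i_not_nonpos: "1 - \<i> * complex_of_real \<theta> \<notin> \<real>\<^sub>\<le>\<^sub>0"
  by (simp add: complex_nonpos_Reals_iff)

lemma norm_exp_log_cf: "norm (exp (log_cf \<theta>)) = exp (- ln (1 + \<theta>\<^sup>2) / 4)"
proof -
  have nz: "1 - \<i> * complex_of_real \<theta> \<noteq> 0"
    using one_minus_i_not_nonpos by force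
  have "norm (1 - \<i> * complex_of_real \<theta>) = sqrt (1 + \<theta>\<^sup>2)"
    by (simp add: cmod_def)
  then have "Re (Ln (1 - \<i> * complex_of_real \<theta>)) = ln (1 + \<theta>\<^sup>2) / 2"
    using nz by (simp add: ln_sqrt add_pos_nonneg)
  then show ?thesis by (simp add: log_cf_def norm_exp_eq_Re)
qed

text \<open>The error has derivative \<open>- i \<theta>\<^sup>2 / (2 (1 - i \<theta>))\<close>, whose modulus is at most \<open>\<theta>\<^sup>2 / 2\<close> because
\<open>\<bar>1 - i \<theta>\<bar> \<ge> 1\<close> on the real line.\<close>

lemma log_cf_quadratic_approx: "norm (log_cf \<theta> + \<theta>\<^sup>2 / 4) \<le> \<bar>\<theta>\<bar> ^ 3 / 6"
proof -
  define q where "q = (\<lambda>\<theta>::real. log_cf \<theta> + (complex_of_real \<theta>)\<^sup>2 / 4)"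
  define q' where "q' = (\<lambda>\<theta>::real. - (\<i> / 2) + (\<i> * inverse (1 - \<i> * \<theta>)) / 2 + complex_of_real \<theta> / 2)"
  have deriv: "(q has_vector_derivative q' \<theta>) (at \<theta>)" for \<theta>
  proof -
    have "((\<lambda>z. - (\<i> * z) / 2 - Ln (1 - \<i> * z) / 2 + z\<^sup>2 / 4) has_field_derivative q' \<theta>)
        (at (complex_of_real \<theta>))"
      unfolding q'_def
      by (auto intro!: derivative_eq_intros one_minus_i_not_nonpos)
    from has_vector_derivative_real_field[OF this] show ?thesis
      by (simp add: q_def log_cf_def)
  qed
  have bound: "norm (q' \<theta>) \<le> \<theta>\<^sup>2 / 2" for \<theta>
  proof -
    have nz: "1 - \<i> * complex_of_real \<theta> \<noteq> 0"
      using one_minus_i_not_nonpos by force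
    have "q' \<theta> = (- \<i> / 2) * \<theta>\<^sup>2 * inverse (1 - \<i> * \<theta>)"
      using nz by (simp add: q'_def field_simps power2_eq_square)
    then have "norm (q' \<theta>) = norm (- \<i> / 2) * norm (complex_of_real (\<theta>\<^sup>2)) * inverse (norm (1 - \<i> * complex_of_real \<theta>))"
      by (simp only: norm_mult norm_inverse)
    also have "norm (- \<i> / 2) = 1 / 2" by simp
    also have "norm (complex_of_real (\<theta>\<^sup>2)) = \<theta>\<^sup>2" unfolding norm_of_real by simp
    also have "1 / 2 * \<theta>\<^sup>2 * inverse (norm (1 - \<i> * complex_of_real \<theta>)) = (\<theta>\<^sup>2 / 2) / norm (1 - \<i> * complex_of_real \<theta>)"
      by (simp only: divide_inverse mult_ac mult_1_left)
    finally have "norm (q' \<theta>) = (\<theta>\<^sup>2 / 2) / norm (1 - \<i> * complex_of_real \<theta>)" .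
    also have "1 \<le> norm (1 - \<i> * complex_of_real \<theta>)" by (simp add: cmod_def)
    then have "(\<theta>\<^sup>2 / 2) / norm (1 - \<i> * complex_of_real \<theta>) \<le> \<theta>\<^sup>2 / 2"
      by (simp add: divide_le_eq mult_le_cancel_left1)
    finally show ?thesis .
  qed
  have mvt: "norm (q b - q a) \<le> b ^ 3 / 6 - a ^ 3 / 6" if "a < b" for a b
  proof (rule differentiable_bound_general[OF that, where f' = q' and \<phi>' = "\<lambda>x. x\<^sup>2 / 2"])
    show "continuous_on {a..b} q"
      using deriv by (meson continuous_at_imp_continuous_on has_vector_derivative_continuous)
    show "(q has_vector_derivative q' x) (at x)" for x by (rule deriv)
    show "((\<lambda>x. x ^ 3 / 6) has_vector_derivative x\<^sup>2 / 2) (at x)" for x :: real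
      unfolding has_real_derivative_iff_has_vector_derivative[symmetric]
      by (auto intro!: derivative_eq_intros simp: field_simps)
    show "norm (q' x) \<le> x\<^sup>2 / 2" for x by (rule bound)
  qed (auto intro!: continuous_intros)
  have q0: "q 0 = 0" by (simp add: q_def log_cf_def)
  have "norm (q \<theta>) \<le> \<bar>\<theta>\<bar> ^ 3 / 6"
    using mvt[of 0 \<theta>] mvt[of \<theta> 0] q0
    by (cases \<theta> "0 :: real" rule: linorder_cases) (auto simp: power3_eq_cube)
  then show ?thesis by (simp add: q_def)
qed

text \<open>Along the segment from \<open>q\<close> to \<open>p\<close> the modulus of the exponential is the exponential of an affine function,
hence lies below its chord by convexity; integrating the chord gives the average of the end values.\<close>

lemma norm_exp_diff_le_trapezoid:
  fixes p q :: complex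
  shows "norm (exp p - exp q) \<le> norm (p - q) * ((norm (exp p) + norm (exp q)) / 2)"
proof -
  define P where "P = exp (Re p)"
  define R where "R = exp (Re q)"
  let ?f = "\<lambda>s::real. exp (q + of_real s * (p - q))"
  \<comment> \<open>a primitive of the chord of the modulus, times \<open>norm (p - q)\<close>\<close>
  let ?\<phi> = "\<lambda>s::real. norm (p - q) * (R * (s - s\<^sup>2 / 2) + P * (s\<^sup>2 / 2))"
  have "norm (?f 1 - ?f 0) \<le> ?\<phi> 1 - ?\<phi> 0"
  proof (rule differentiable_bound_general[where f' = "\<lambda>s. (p - q) * ?f s"
        and \<phi>' = "\<lambda>s. norm (p - q) * ((1 - s) * R + s * P)"])
    show "(?f has_vector_derivative (p - q) * ?f s) (at s)" for s :: real
      by (rule has_vector_derivative_real_field) (auto intro!: derivative_eq_intros)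
    show "(?\<phi> has_vector_derivative norm (p - q) * ((1 - s) * R + s * P)) (at s)" for s :: real
      unfolding has_real_derivative_iff_has_vector_derivative[symmetric]
      by (auto intro!: derivative_eq_intros simp: field_simps)
    fix s :: real assume s: "0 < s" "s < 1"
    have "exp ((1 - s) *\<^sub>R Re q + s *\<^sub>R Re p) \<le> (1 - s) * R + s * P"
      unfolding P_def R_def by (rule convex_onD[OF exp_convex]) (use s in auto)
    then have "norm (?f s) \<le> (1 - s) * R + s * P"
      by (simp add: norm_exp_eq_Re algebra_simps)
    then show "norm ((p - q) * ?f s) \<le> norm (p - q) * ((1 - s) * R + s * P)"
      unfolding norm_mult by (intro mult_left_mono) auto
  qed (auto intro!: continuous_intros)
  then show ?thesis by (simp add: norm_exp_eq_Re P_def R_def algebra_simps)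
qed

text \<open>Concavity of the logarithm. Applied with a common \<open>c\<close> to all eigenvalues, it reduces the product of the moduli
to its extremal case.\<close>

lemma ln_one_plus_chord:
  fixes x c :: real
  assumes "0 \<le> x" "x \<le> c" "0 < c"
  shows "x / c * ln (1 + c) \<le> ln (1 + x)"
proof -
  define t where "t = x / c"
  have t: "0 \<le> t" "t \<le> 1" "x = t * c" using assms by (auto simp: t_def)
  have "(1 - t) * ln 1 + t * ln (1 + c) \<le> ln ((1 - t) *\<^sub>R 1 + t *\<^sub>R (1 + c))"
    by (rule concave_onD[OF ln_concave]) (use assms t in auto)
  also have "(1 - t) *\<^sub>R 1 + t *\<^sub>R (1 + c) = 1 + x" by (simp add: t algebra_simps)
  finally show ?thesis by (simp add: t_def)
qed

text \<open>The substitution \<open>u = 1 + c s\<^sup>2\<close> makes the integrand a combination of two powers of \<open>u\<close>, which yields an explicit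
primitive; \<open>k > 2\<close> makes it vanish at infinity.\<close>

lemma has_bochner_integral_cubed_rational_weight:
  fixes c k :: real
  assumes c: "0 < c" and k: "2 < k"
  shows "has_bochner_integral lborel (\<lambda>s. \<bar>s\<bar> ^ 3 * (1 + c * s\<^sup>2) powr (- k))
           (1 / (c\<^sup>2 * (k - 1) * (k - 2)))"
proof -
  let ?f = "\<lambda>s::real. \<bar>s\<bar> ^ 3 * (1 + c * s\<^sup>2) powr (- k)"
  let ?F = "\<lambda>s::real. (1 / (2 * c\<^sup>2)) * ((1 + c * s\<^sup>2) powr (2 - k) / (2 - k) - (1 + c * s\<^sup>2) powr (1 - k) / (1 - k))"
  have pos: "0 < 1 + c * s\<^sup>2" for s using c by (simp add: add_pos_nonneg)
  have inf: "filterlim (\<lambda>s::real. 1 + c * s\<^sup>2) at_top at_top"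
    using c by real_asymp
  have lim0: "((\<lambda>s. (1 + c * s\<^sup>2) powr e) \<longlongrightarrow> 0) at_top" if "e < 0" for e
    using tendsto_neg_powr[OF that inf] .
  have "((\<lambda>s. (1 / (2 * c\<^sup>2)) * ((1 + c * s\<^sup>2) powr (2 - k) / (2 - k) - (1 + c * s\<^sup>2) powr (1 - k) / (1 - k)))
      \<longlongrightarrow> (1 / (2 * c\<^sup>2)) * (0 / (2 - k) - 0 / (1 - k))) at_top"
    using k by (intro tendsto_intros lim0) auto
  then have lim: "(?F \<longlongrightarrow> 0) at_top" by simp
  have deriv: "DERIV ?F s :> ?f s" if "0 \<le> s" for s
  proof -
    have e: "(1 + c * s\<^sup>2) powr (1 - k) = (1 + c * s\<^sup>2) * (1 + c * s\<^sup>2) powr (- k)"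
      using pos[of s] by (simp add: powr_diff powr_minus divide_inverse)
    have d: "DERIV (\<lambda>s. (1 + c * s\<^sup>2) powr e / e) s :> (2 * c * s) * (1 + c * s\<^sup>2) powr (e - 1)"
      if "e \<noteq> 0" for e
    proof -
      have "DERIV (\<lambda>s. 1 + c * s\<^sup>2) s :> 2 * c * s"
        by (auto intro!: derivative_eq_intros)
      from DERIV_cdivide[OF DERIV_fun_powr[OF this pos, of e], of e] show ?thesis
        using that by (simp add: mult_ac)
    qed
    have "DERIV ?F s :> (1 / (2 * c\<^sup>2)) * ((2 * c * s) * (1 + c * s\<^sup>2) powr (1 - k) - (2 * c * s) * (1 + c * s\<^sup>2) powr (- k))"
      using DERIV_cmult[OF DERIV_diff[OF d[of "2 - k"] d[of "1 - k"]], of "1 / (2 * c\<^sup>2)"] k by simp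
    also have "(1 / (2 * c\<^sup>2)) * ((2 * c * s) * (1 + c * s\<^sup>2) powr (1 - k) - (2 * c * s) * (1 + c * s\<^sup>2) powr (- k))
       = ?f s"
      unfolding e using c that by (simp add: field_simps power2_eq_square power3_eq_cube)
    finally show ?thesis .
  qed
  let ?I = "1 / (2 * c\<^sup>2 * (k - 1) * (k - 2))"
  have F0: "0 - ?F 0 = ?I"
    using c k by (simp add: divide_simps) (simp add: algebra_simps)
  have "(\<integral>\<^sup>+s. ennreal (?f s) * indicator {0..} s \<partial>lborel) = 0 - ?F 0"
    by (rule nn_integral_FTC_atLeast) (use deriv lim in auto)
  then have nn: "(\<integral>\<^sup>+s. ennreal (indicator {0..} s *\<^sub>R ?f s) \<partial>lborel) = ennreal ?I"
    unfolding F0 by (subst nn_integral_cong[where v = "\<lambda>s. ennreal (?f s) * indicator {0..} s"])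
      (auto split: split_indicator)
  have "has_bochner_integral lborel (\<lambda>s. indicator {0..} s *\<^sub>R ?f s) ?I"
    by (rule has_bochner_integral_nn_integral[OF _ _ _ nn]) (use k c in auto)
  from has_bochner_integral_even_function[OF this]
  have "has_bochner_integral lborel ?f (2 *\<^sub>R ?I)" by simp
  then show ?thesis by (simp add: mult.assoc)
qed

lemma has_bochner_integral_cubed_gaussian:
  "has_bochner_integral lborel (\<lambda>s::real. \<bar>s\<bar> ^ 3 * exp (- s\<^sup>2 / 2)) 4"
proof -
  have "has_bochner_integral lborel (\<lambda>s. sqrt (2 * pi) * (std_normal_density s * \<bar>s\<bar> ^ (2 * 1 + 1)))
      (sqrt (2 * pi) * (sqrt (2 / pi) * 2 ^ 1 * fact 1))"
    by (intro has_bochner_integral_mult_right std_normal_moment_abs_odd)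
  moreover have "sqrt (2 * pi) * (sqrt (2 / pi) * 2 ^ 1 * fact 1) = 4"
    by (simp add: real_sqrt_mult real_sqrt_divide field_simps)
  moreover have "(\<lambda>s. sqrt (2 * pi) * (std_normal_density s * \<bar>s\<bar> ^ (2 * 1 + 1))) = (\<lambda>s. \<bar>s\<bar> ^ 3 * exp (- s\<^sup>2 / 2))"
  proof
    fix s :: real
    have "sqrt (2 * pi) * std_normal_density s = exp (- s\<^sup>2 / 2)"
      by (simp add: std_normal_density_def)
    then show "sqrt (2 * pi) * (std_normal_density s * \<bar>s\<bar> ^ (2 * 1 + 1)) = \<bar>s\<bar> ^ 3 * exp (- s\<^sup>2 / 2)"
      by (simp flip: mult.assoc)
  qed
  ultimately show ?thesis by (simp only:)
qed

text \<open>The normalization \<open>\<Sum>\<^sub>i \<mu>\<^sub>i\<^sup>2 = 2\<close> is the one under which \<open>\<Sum>\<^sub>i \<mu>\<^sub>i (X\<^sub>i\<^sup>2 - 1) / 2\<close> has unit variance. In the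
first bound \<open>ln_one_plus_chord\<close> makes the exponent a multiple of this sum of squares; in the second, one of the
three factors \<open>\<bar>\<mu>\<^sub>i\<bar>\<close> in the cubic error is replaced by its maximum and the other two are summed exactly.\<close>

lemma standardized_quadratic_cf_bounds:
  fixes \<mu> :: "'i::finite \<Rightarrow> real" and a s :: real
  assumes a: "0 < a" and var: "(\<Sum>i\<in>UNIV. (\<mu> i)\<^sup>2) = 2" and max: "\<And>i. \<bar>\<mu> i\<bar> \<le> sqrt 2 * a"
  defines "\<Phi> \<equiv> \<Prod>i\<in>UNIV. exp (log_cf (s * \<mu> i))"
    and "w \<equiv> (1 + 2 * a\<^sup>2 * s\<^sup>2) powr (- (1 / (4 * a\<^sup>2)))"
  shows "norm \<Phi> \<le> w"
    and "norm (\<Phi> - exp (- s\<^sup>2 / 2)) \<le> sqrt 2 / 6 * a * (\<bar>s\<bar> ^ 3 * w + \<bar>s\<bar> ^ 3 * exp (- s\<^sup>2 / 2))"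
proof -
  have max2: "(\<mu> i)\<^sup>2 \<le> 2 * a\<^sup>2" for i
    using power_mono[OF max[of i] abs_ge_zero, of 2] by (simp add: power_mult_distrib)
  show w: "norm \<Phi> \<le> w"
  proof (cases "s = 0")
    case True
    then show ?thesis by (simp add: \<Phi>_def w_def log_cf_def flip: prod_norm)
  next
    case False
    \<comment> \<open>each \<open>(s \<mu>\<^sub>i)\<^sup>2\<close> lies between \<open>0\<close> and this common bound\<close>
    let ?c = "2 * a\<^sup>2 * s\<^sup>2"
    have "(1 / a\<^sup>2) * ln (1 + ?c) = (\<Sum>i\<in>UNIV. (\<mu> i)\<^sup>2) / (2 * a\<^sup>2) * ln (1 + ?c)"
      by (simp add: var)
    also have "\<dots> = (\<Sum>i\<in>UNIV. (s * \<mu> i)\<^sup>2 / ?c * ln (1 + ?c))"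
      using False by (simp add: sum_distrib_right sum_divide_distrib power_mult_distrib)
    also have "\<dots> \<le> (\<Sum>i\<in>UNIV. ln (1 + (s * \<mu> i)\<^sup>2))"
      using False a max2
      by (intro sum_mono ln_one_plus_chord) (auto simp: power_mult_distrib mult.commute[of "s\<^sup>2"] intro: mult_right_mono)
    finally have "exp (- (\<Sum>i\<in>UNIV. ln (1 + (s * \<mu> i)\<^sup>2)) / 4) \<le> exp (- (1 / (4 * a\<^sup>2)) * ln (1 + ?c))"
      by simp
    moreover have "norm \<Phi> = exp (\<Sum>i\<in>UNIV. - ln (1 + (s * \<mu> i)\<^sup>2) / 4)"
      unfolding \<Phi>_def exp_sum[OF finite] prod_norm[symmetric] norm_exp_log_cf ..
    then have "norm \<Phi> = exp (- (\<Sum>i\<in>UNIV. ln (1 + (s * \<mu> i)\<^sup>2)) / 4)"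
      by (simp add: sum_negf sum_divide_distrib)
    moreover have "0 < 1 + ?c" by (simp add: add_pos_nonneg)
    ultimately show ?thesis by (simp add: w_def powr_def)
  qed
  define p where "p = (\<Sum>i\<in>UNIV. log_cf (s * \<mu> i))"
  define q where "q = - (complex_of_real s)\<^sup>2 / 2"
  have p: "exp p = \<Phi>" by (simp add: p_def \<Phi>_def exp_sum)
  have q: "exp q = complex_of_real (exp (- s\<^sup>2 / 2))" by (simp add: q_def exp_of_real[symmetric])
  have nq: "norm (exp q) = exp (- s\<^sup>2 / 2)" unfolding q by (simp del: of_real_exp)
  have "p - q = (\<Sum>i\<in>UNIV. log_cf (s * \<mu> i) + complex_of_real ((s * \<mu> i)\<^sup>2 / 4))"
  proof -
    have "(\<Sum>i\<in>UNIV. complex_of_real ((s * \<mu> i)\<^sup>2 / 4)) = complex_of_real (s\<^sup>2 / 4 * (\<Sum>i\<in>UNIV. (\<mu> i)\<^sup>2))"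
      by (simp add: sum_distrib_left power_mult_distrib)
    then show ?thesis by (simp add: sum.distrib p_def q_def var)
  qed
  also have "norm \<dots> \<le> (\<Sum>i\<in>UNIV. \<bar>s * \<mu> i\<bar> ^ 3 / 6)"
    using log_cf_quadratic_approx[of "s * \<mu> i" for i] by (intro sum_norm_le) simp
  also have "\<dots> \<le> (\<Sum>i\<in>UNIV. \<bar>s\<bar> ^ 3 * (sqrt 2 * a) / 6 * (\<mu> i)\<^sup>2)"
  proof (intro sum_mono)
    fix i
    have "\<bar>s * \<mu> i\<bar> ^ 3 = \<bar>s\<bar> ^ 3 * (\<bar>\<mu> i\<bar> * (\<mu> i)\<^sup>2)"
      unfolding abs_mult power_mult_distrib power2_abs[of "\<mu> i", symmetric]
      by (simp only: power3_eq_cube power2_eq_square mult.assoc)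
    also have "\<dots> \<le> \<bar>s\<bar> ^ 3 * ((sqrt 2 * a) * (\<mu> i)\<^sup>2)"
      by (intro mult_left_mono mult_right_mono max) auto
    finally show "\<bar>s * \<mu> i\<bar> ^ 3 / 6 \<le> \<bar>s\<bar> ^ 3 * (sqrt 2 * a) / 6 * (\<mu> i)\<^sup>2" by simp
  qed
  also have "\<dots> = \<bar>s\<bar> ^ 3 * (sqrt 2 * a) / 3"
    unfolding sum_distrib_left[symmetric] var by simp
  finally have pq: "norm (p - q) \<le> \<bar>s\<bar> ^ 3 * (sqrt 2 * a) / 3" .
  have "norm (\<Phi> - exp (- s\<^sup>2 / 2)) = norm (exp p - exp q)" by (simp add: p q)
  also have "\<dots> \<le> norm (p - q) * ((norm (exp p) + norm (exp q)) / 2)"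
    by (rule norm_exp_diff_le_trapezoid)
  also have "\<dots> \<le> \<bar>s\<bar> ^ 3 * (sqrt 2 * a) / 3 * ((w + exp (- s\<^sup>2 / 2)) / 2)"
    unfolding nq p using pq w a
    by (intro mult_mono divide_right_mono add_mono) auto
  also have "\<dots> = sqrt 2 / 6 * a * (\<bar>s\<bar> ^ 3 * w + \<bar>s\<bar> ^ 3 * exp (- s\<^sup>2 / 2))"
    by (simp add: algebra_simps)
  finally show "norm (\<Phi> - exp (- s\<^sup>2 / 2)) \<le> sqrt 2 / 6 * a * (\<bar>s\<bar> ^ 3 * w + \<bar>s\<bar> ^ 3 * exp (- s\<^sup>2 / 2))" .
qed

text \<open>With \<open>y = 1 - 8 a\<^sup>2\<close> the claim is an inequality between rational functions of \<open>y\<close> on the interval from \<open>0\<close> to \<open>1\<close>.\<close>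

lemma integrated_bound_le_stated_constant:
  fixes a :: real
  assumes a: "0 < a" "8 * a\<^sup>2 < 1"
  shows "1 / (2 * pi) * (sqrt 2 / 6 * a * (4 / ((1 - 4 * a\<^sup>2) * (1 - 8 * a\<^sup>2)) + 4))
     \<le> 0.14 * (4 + 0.29 / (1 - 8 * a\<^sup>2)\<^sup>2) * a"
proof -
  define y where "y = 1 - 8 * a\<^sup>2"
  have y: "0 < y" "y \<le> 1" "1 - 4 * a\<^sup>2 = (1 + y) / 2" using a by (auto simp: y_def)
  have "sqrt 2 \<le> 1.4143" by (rule real_le_lsqrt) (auto simp: power2_eq_square)
  moreover have "3.14 \<le> pi" using pi_approx(1) by simp
  ultimately have c: "1 / (2 * pi) * (sqrt 2 / 6) \<le> 0.03755"
    by (simp add: field_simps)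
  have "0.03755 * (4 / ((1 + y) / 2 * y) + 4) \<le> 0.14 * (4 + 0.29 / y\<^sup>2)"
  proof -
    \<comment> \<open>after clearing denominators this is a cubic that stays positive on \<open>y > 0\<close>\<close>
    \<comment> \<open>tangents of \<open>y\<^sup>3\<close> and \<open>y\<^sup>2\<close> at \<open>47 / 200\<close>, a point close to the minimum of the cubic\<close>
    have "0 \<le> (y - 47 / 200)\<^sup>2 * (y + 47 / 100)" "0 \<le> (y - 47 / 200)\<^sup>2" using y by auto
    moreover have "(y - 47 / 200)\<^sup>2 * (y + 47 / 100) = y ^ 3 - 6627 / 40000 * y + 103823 / 4000000"
      "(y - 47 / 200)\<^sup>2 = y\<^sup>2 - 47 / 100 * y + 2209 / 40000"
      by (simp_all add: power2_eq_square power3_eq_cube field_simps)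
    ultimately have "0 \<le> 2049 / 5000 * y ^ 3 + 2049 / 5000 * y\<^sup>2 - 1299 / 5000 * y + 203 / 5000"
      using y(1) by linarith
    then have "0 \<le> (2049 / 5000 * y ^ 3 + 2049 / 5000 * y\<^sup>2 - 1299 / 5000 * y + 203 / 5000) / (y\<^sup>2 * (1 + y))"
      using y by simp
    also have "\<dots> = 0.14 * (4 + 0.29 / y\<^sup>2) - 0.03755 * (4 / ((1 + y) / 2 * y) + 4)"
      using y(1) by (simp add: divide_simps power2_eq_square power3_eq_cube) (simp add: algebra_simps)
    finally show ?thesis by simp
  qed
  then have "0.03755 * (4 / ((1 - 4 * a\<^sup>2) * (1 - 8 * a\<^sup>2)) + 4) \<le> 0.14 * (4 + 0.29 / (1 - 8 * a\<^sup>2)\<^sup>2)"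
    unfolding y(3) y_def[symmetric] .
  moreover have "1 / (2 * pi) * (sqrt 2 / 6) * (4 / ((1 - 4 * a\<^sup>2) * (1 - 8 * a\<^sup>2)) + 4) \<le>
     0.03755 * (4 / ((1 - 4 * a\<^sup>2) * (1 - 8 * a\<^sup>2)) + 4)"
    using c by (rule mult_right_mono) (use a in auto)
  ultimately have "1 / (2 * pi) * (sqrt 2 / 6) * (4 / ((1 - 4 * a\<^sup>2) * (1 - 8 * a\<^sup>2)) + 4) \<le>
     0.14 * (4 + 0.29 / (1 - 8 * a\<^sup>2)\<^sup>2)"
    by linarith
  from mult_right_mono[OF this, of a] show ?thesis
    using a(1) by (simp only: mult_ac less_imp_le)
qed

section \<open>Gaussian vectors and the characteristic function of a squared normal variable\<close>

lemma nn_integral_lborel_shift: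
  fixes f :: "'a::euclidean_space \<Rightarrow> ennreal"
  assumes [measurable]: "f \<in> borel_measurable borel"
  shows "(\<integral>\<^sup>+x. f (c + x) \<partial>lborel) = (\<integral>\<^sup>+x. f x \<partial>lborel)"
proof -
  have "(\<integral>\<^sup>+x. f x \<partial>distr lborel borel ((+) c)) = (\<integral>\<^sup>+x. f (c + x) \<partial>lborel)"
    by (rule nn_integral_distr) auto
  then show ?thesis by (simp add: lborel_distr_plus)
qed

text \<open>Both measures are translation invariant, and such measures are proportional: evaluate the double integral of
\<open>1\<^sub>B(L z) 1\<^sub>U(x - L z)\<close> in both orders, with a symmetric set \<open>U\<close> of finite positive measure. The
factor is left unspecified, since in the application it is determined by normalization.\<close>

lemma distr_lborel_linear:
  fixes L :: "'a::euclidean_space \<Rightarrow> 'a"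
  assumes lin: "linear L" and bij: "bij L"
  obtains c where "distr lborel borel L = density lborel (\<lambda>_. c)"
proof -
  have [measurable]: "L \<in> borel_measurable borel"
    using linear_continuous_on_compose[OF continuous_on_id lin]
    by (intro borel_measurable_continuous_onI) auto
  define U :: "'a set" where "U = ball 0 1"
  have [measurable]: "U \<in> sets borel" by (simp add: U_def)
  have symU: "- x \<in> U \<longleftrightarrow> x \<in> U" for x by (simp add: U_def)
  define u where "u = emeasure lborel U"
  define m where "m = emeasure lborel (L -` U)"
  have vim: "L -` B \<in> sets borel" if "B \<in> sets borel" for B
    using measurable_sets[of L borel borel B] that by simp
  have u: "u \<noteq> 0" "u \<noteq> top"
    using content_ball_pos[of 1 "0 :: 'a"] emeasure_lborel_ball_finite[of "0 :: 'a" 1]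
    by (auto simp: u_def U_def measure_def)
  have key: "emeasure lborel (L -` B) * u = emeasure lborel B * m" if B [measurable]: "B \<in> sets borel" for B
  proof -
    have "emeasure lborel (L -` B) * u = (\<integral>\<^sup>+z. indicator (L -` B) z * u \<partial>lborel)"
      using vim[OF B] by (simp add: nn_integral_multc)
    also have "\<dots> = (\<integral>\<^sup>+z. \<integral>\<^sup>+x. indicator B (L z) * indicator U (x - L z) \<partial>lborel \<partial>lborel)"
    proof (rule nn_integral_cong)
      fix z
      have "(\<integral>\<^sup>+x. indicator B (L z) * indicator U (x - L z) \<partial>lborel)
          = indicator B (L z) * (\<integral>\<^sup>+x. indicator U (- L z + x) \<partial>lborel)"
        by (subst nn_integral_cmult[symmetric]) auto
      also have "(\<integral>\<^sup>+x. indicator U (- L z + x) \<partial>lborel) = (\<integral>\<^sup>+x. indicator U x \<partial>lborel)"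
        by (rule nn_integral_lborel_shift) measurable
      finally show "indicator (L -` B) z * u = (\<integral>\<^sup>+x. indicator B (L z) * indicator U (x - L z) \<partial>lborel)"
        by (simp add: u_def indicator_vimage)
    qed
    also have "\<dots> = (\<integral>\<^sup>+x. \<integral>\<^sup>+z. indicator B (L z) * indicator U (x - L z) \<partial>lborel \<partial>lborel)"
      by (rule lborel_pair.Fubini') measurable
    also have "\<dots> = (\<integral>\<^sup>+x. \<integral>\<^sup>+z. indicator B (L z + x) * indicator U (L z) \<partial>lborel \<partial>lborel)"
    proof (rule nn_integral_cong)
      fix x
      obtain w where w: "L w = x" using bij by (metis bij_pointE)
      have "(\<integral>\<^sup>+z. indicator B (L z) * indicator U (x - L z) \<partial>lborel)
          = (\<integral>\<^sup>+z. indicator B (L (w + z)) * indicator U (x - L (w + z)) \<partial>lborel)"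
        by (rule nn_integral_lborel_shift[symmetric]) measurable
      also have "\<dots> = (\<integral>\<^sup>+z. indicator B (L z + x) * indicator U (L z) \<partial>lborel)"
        using symU by (intro nn_integral_cong) (simp add: linear_add[OF lin] w add.commute indicator_def)
      finally show "(\<integral>\<^sup>+z. indicator B (L z) * indicator U (x - L z) \<partial>lborel)
          = (\<integral>\<^sup>+z. indicator B (L z + x) * indicator U (L z) \<partial>lborel)" .
    qed
    also have "\<dots> = (\<integral>\<^sup>+z. \<integral>\<^sup>+x. indicator B (L z + x) * indicator U (L z) \<partial>lborel \<partial>lborel)"
      by (rule lborel_pair.Fubini'[symmetric]) measurable
    also have "\<dots> = (\<integral>\<^sup>+z. emeasure lborel B * indicator (L -` U) z \<partial>lborel)"
    proof (rule nn_integral_cong)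
      fix z
      have "(\<integral>\<^sup>+x. indicator B (L z + x) * indicator U (L z) \<partial>lborel)
          = (\<integral>\<^sup>+x. indicator B (L z + x) \<partial>lborel) * indicator U (L z)"
        by (subst nn_integral_multc[symmetric]) auto
      also have "(\<integral>\<^sup>+x. indicator B (L z + x) \<partial>lborel) = (\<integral>\<^sup>+x. indicator B x \<partial>lborel)"
        by (rule nn_integral_lborel_shift) measurable
      finally show "(\<integral>\<^sup>+x. indicator B (L z + x) * indicator U (L z) \<partial>lborel) = emeasure lborel B * indicator (L -` U) z"
        by (simp add: indicator_vimage)
    qed
    also have "\<dots> = emeasure lborel B * m"
      using vim[of U] by (simp add: m_def nn_integral_cmult)
    finally show ?thesis .
  qed
  have "distr lborel borel L = density lborel (\<lambda>_. m / u)"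
  proof (rule measure_eqI)
    fix B assume "B \<in> sets (distr lborel borel L)"
    then have B: "B \<in> sets borel" by simp
    have "emeasure lborel (L -` B) = emeasure lborel (L -` B) * u / u"
      using u by (simp add: mult_divide_eq_ennreal)
    also have "\<dots> = m / u * emeasure lborel B"
      unfolding key[OF B] by (simp add: divide_ennreal_def mult_ac)
    finally show "emeasure (distr lborel borel L) B = emeasure (density lborel (\<lambda>_. m / u)) B"
      using B by (simp add: emeasure_distr emeasure_density_const)
  qed simp
  then show ?thesis by (rule that)
qed

definition std_gaussian :: "(real ^ 'n) measure" where
  "std_gaussian = density lborel (\<lambda>x. ennreal (\<Prod>i\<in>UNIV. std_normal_density (x $ i)))"

lemma sets_std_gaussian [measurable_cong, simp]: "sets std_gaussian = sets borel"
  by (simp add: std_gaussian_def)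

lemma measurable_vec_lambda_PiM:
  "(\<lambda>f. \<chi> i. f i) \<in> borel_measurable (Pi\<^sub>M UNIV (\<lambda>_ :: 'n::finite. lborel :: real measure))"
  by (subst borel_measurable_euclidean_space) (auto simp: Basis_vec_def inner_axis)

text \<open>This form of Lebesgue measure on vectors lets integrals of products of functions of single coordinates factor.\<close>

lemma lborel_vec_eq_PiM:
  "(lborel :: (real ^ 'n) measure) = distr (Pi\<^sub>M UNIV (\<lambda>_ :: 'n. lborel)) borel (\<lambda>f. \<chi> i. f i)"
proof (rule lborel_eqI)
  interpret product_sigma_finite "\<lambda>i :: 'n. lborel :: real measure" ..
  fix l u :: "real ^ 'n"
  assume le: "\<And>b. b \<in> Basis \<Longrightarrow> l \<bullet> b \<le> u \<bullet> b"
  have le': "l $ i \<le> u $ i" for i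
    using le[of "axis i 1"] by (simp add: inner_axis)
  have basis: "(\<Prod>b\<in>Basis. (u - l) \<bullet> b) = (\<Prod>i\<in>UNIV. u $ i - l $ i)"
  proof -
    have "Basis = range (\<lambda>i::'n. axis i (1::real))" by (auto simp: Basis_vec_def)
    then have "(\<Prod>b\<in>Basis. (u - l) \<bullet> b) = (\<Prod>b\<in>range (\<lambda>i::'n. axis i (1::real)). (u - l) \<bullet> b)"
      by (simp only:)
    also have "\<dots> = (\<Prod>i\<in>UNIV. u $ i - l $ i)"
      by (subst prod.reindex) (auto simp: inj_on_def axis_eq_axis inner_axis)
    finally show ?thesis .
  qed
  have "emeasure (distr (Pi\<^sub>M UNIV (\<lambda>_ :: 'n. lborel)) borel (\<lambda>f. \<chi> i. f i)) (box l u)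
      = emeasure (Pi\<^sub>M UNIV (\<lambda>_ :: 'n. lborel)) (\<Pi>\<^sub>E i\<in>UNIV. {l $ i <..< u $ i})"
    by (subst emeasure_distr[OF measurable_vec_lambda_PiM])
      (auto simp: mem_box_cart space_PiM PiE_iff intro!: arg_cong[where f = "emeasure _"])
  also have "\<dots> = ennreal (\<Prod>i\<in>UNIV. u $ i - l $ i)"
    by (subst emeasure_PiM) (auto simp: le' prod_ennreal)
  finally show "emeasure (distr (Pi\<^sub>M UNIV (\<lambda>_ :: 'n. lborel)) borel (\<lambda>f. \<chi> i. f i)) (box l u)
      = (\<Prod>b\<in>Basis. (u - l) \<bullet> b)" by (simp add: basis)
qed simp

lemma prob_space_std_gaussian: "prob_space (std_gaussian :: (real ^ 'n) measure)"
proof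
  interpret product_sigma_finite "\<lambda>i :: 'n. lborel :: real measure" ..
  have one: "(\<integral>\<^sup>+x. ennreal (std_normal_density x) \<partial>lborel) = 1"
    using prob_space.emeasure_space_1[OF prob_space_normal_density[of 1 0]]
    by (simp add: emeasure_density)
  have "emeasure (std_gaussian :: (real ^ 'n) measure) (space std_gaussian)
      = (\<integral>\<^sup>+x. (\<Prod>i\<in>UNIV. ennreal (std_normal_density (x $ i))) \<partial>(lborel :: (real ^ 'n) measure))"
    by (simp add: std_gaussian_def emeasure_density prod_ennreal)
  also have "\<dots> = (\<integral>\<^sup>+x. (\<Prod>i\<in>UNIV. ennreal (std_normal_density (x i))) \<partial>(Pi\<^sub>M UNIV (\<lambda>_ :: 'n. lborel)))"
    unfolding lborel_vec_eq_PiM by (subst nn_integral_distr[OF measurable_vec_lambda_PiM]) auto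
  also have "\<dots> = 1"
    by (subst product_nn_integral_prod) (auto simp: one)
  finally show "emeasure (std_gaussian :: (real ^ 'n) measure) (space std_gaussian) = 1" .
qed

lemma integral_std_gaussian_prod:
  fixes f :: "'n::finite \<Rightarrow> real \<Rightarrow> complex"
  assumes int: "\<And>i. integrable std_normal_distribution (f i)"
  shows "(CLINT x|std_gaussian. \<Prod>i\<in>UNIV. f i (x $ i)) = (\<Prod>i\<in>UNIV. CLINT x|std_normal_distribution. f i x)"
proof -
  interpret product_sigma_finite "\<lambda>i :: 'n. lborel :: real measure" ..
  have [measurable]: "f i \<in> borel_measurable borel" for i
    using borel_measurable_integrable[OF int] by simp
  have int': "integrable lborel (\<lambda>x. std_normal_density x *\<^sub>R f i x)" for i
    using int by (simp add: integrable_density)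
  have "(CLINT x|std_gaussian. \<Prod>i\<in>UNIV. f i (x $ i))
      = (CLINT x|(lborel :: (real ^ 'n) measure). (\<Prod>i\<in>UNIV. std_normal_density (x $ i)) *\<^sub>R (\<Prod>i\<in>UNIV. f i (x $ i)))"
    unfolding std_gaussian_def by (rule integral_density) (auto intro!: prod_nonneg)
  also have "\<dots> = (CLINT x|(lborel :: (real ^ 'n) measure). \<Prod>i\<in>UNIV. std_normal_density (x $ i) *\<^sub>R f i (x $ i))"
    by (simp add: scaleR_conv_of_real prod.distrib)
  also have "\<dots> = (CLINT x|(Pi\<^sub>M UNIV (\<lambda>_ :: 'n. lborel)). \<Prod>i\<in>UNIV. std_normal_density (x i) *\<^sub>R f i (x i))"
    unfolding lborel_vec_eq_PiM by (subst integral_distr[OF measurable_vec_lambda_PiM]) auto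
  also have "\<dots> = (\<Prod>i\<in>UNIV. CLINT x|lborel. std_normal_density x *\<^sub>R f i x)"
    by (rule product_integral_prod) (auto intro: int')
  also have "\<dots> = (\<Prod>i\<in>UNIV. CLINT x|std_normal_distribution. f i x)"
    by (simp add: integral_density)
  finally show ?thesis .
qed

text \<open>Both the normalizing constant \<open>k\<close> of the density and the Jacobian factor of \<open>L\<close> are absorbed in one constant,
which equals \<open>1\<close> because both sides are probability measures; no determinant has to be computed.\<close>

lemma distr_linear_std_gaussian:
  fixes Y :: "'a \<Rightarrow> real ^ 'n" and L :: "real ^ 'n \<Rightarrow> real ^ 'n"
  assumes M: "prob_space M" and lin: "linear L" and bij: "bij L"
    and Y: "distributed M lborel Y (\<lambda>y. ennreal (k * exp (- (norm (L y))\<^sup>2 / 2)))"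
  shows "distr M borel (\<lambda>\<omega>. L (Y \<omega>)) = std_gaussian"
proof -
  interpret M: prob_space M by (rule M)
  interpret G: prob_space "std_gaussian :: (real ^ 'n) measure" by (rule prob_space_std_gaussian)
  have L [measurable]: "L \<in> borel_measurable borel"
    using linear_continuous_on_compose[OF continuous_on_id lin]
    by (intro borel_measurable_continuous_onI) auto
  have Ym [measurable]: "Y \<in> borel_measurable M"
    using distributed_measurable[OF Y] by simp
  obtain c where c: "distr lborel borel L = density lborel (\<lambda>_. c)"
    using distr_lborel_linear[OF lin bij] .
  define p where "p = (\<lambda>x :: real ^ 'n. ennreal (\<Prod>i\<in>UNIV. std_normal_density (x $ i)))"
  have [measurable]: "p \<in> borel_measurable borel" unfolding p_def by measurable
  define C where "C = c * (ennreal k * ennreal (sqrt (2 * pi) ^ CARD('n)))"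
  have p: "ennreal (k * exp (- (norm x)\<^sup>2 / 2)) = ennreal k * ennreal (sqrt (2 * pi) ^ CARD('n)) * p x" for x
  proof -
    have "(norm x)\<^sup>2 = (\<Sum>i\<in>UNIV. (x $ i)\<^sup>2)"
      unfolding power2_norm_eq_inner inner_vec_def by (simp add: power2_eq_square)
    then have "exp (- (norm x)\<^sup>2 / 2) = (\<Prod>i\<in>UNIV. exp (- (x $ i)\<^sup>2 / 2))"
      by (simp add: exp_sum[symmetric] sum_negf sum_divide_distrib)
    also have "\<dots> = (\<Prod>i\<in>UNIV. sqrt (2 * pi) * std_normal_density (x $ i))"
      by (simp add: std_normal_density_def)
    also have "\<dots> = sqrt (2 * pi) ^ CARD('n) * (\<Prod>i\<in>UNIV. std_normal_density (x $ i))"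
      by (simp add: prod.distrib)
    finally show ?thesis
      by (simp add: p_def ennreal_mult'' prod_nonneg mult.assoc)
  qed
  have dens: "emeasure (distr M borel (\<lambda>\<omega>. L (Y \<omega>))) B = C * emeasure std_gaussian B" if [measurable]: "B \<in> sets borel" for B
  proof -
    have "emeasure (distr M borel (\<lambda>\<omega>. L (Y \<omega>))) B = (\<integral>\<^sup>+x. indicator B x \<partial>distr M borel (\<lambda>\<omega>. L (Y \<omega>)))"
      by simp
    also have "\<dots> = (\<integral>\<^sup>+\<omega>. indicator B (L (Y \<omega>)) \<partial>M)"
      by (rule nn_integral_distr) measurable
    also have "\<dots> = (\<integral>\<^sup>+y. ennreal (k * exp (- (norm (L y))\<^sup>2 / 2)) * indicator B (L y) \<partial>lborel)"
      by (rule distributed_nn_integral[OF Y, symmetric]) measurable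
    also have "\<dots> = (\<integral>\<^sup>+x. ennreal (k * exp (- (norm x)\<^sup>2 / 2)) * indicator B x \<partial>distr lborel borel L)"
      by (rule nn_integral_distr[symmetric]) measurable
    also have "\<dots> = (\<integral>\<^sup>+x. c * (ennreal (k * exp (- (norm x)\<^sup>2 / 2)) * indicator B x) \<partial>lborel)"
      unfolding c by (rule nn_integral_density) measurable
    also have "\<dots> = (\<integral>\<^sup>+x. C * (p x * indicator B x) \<partial>lborel)"
      unfolding p by (simp add: C_def mult_ac)
    also have "\<dots> = C * (\<integral>\<^sup>+x. p x * indicator B x \<partial>lborel)"
      by (rule nn_integral_cmult) measurable
    also have "(\<integral>\<^sup>+x. p x * indicator B x \<partial>lborel) = emeasure std_gaussian B"
      unfolding std_gaussian_def p_def by (subst emeasure_density) auto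
    finally show ?thesis .
  qed
  have "C = 1"
    using dens[of UNIV] G.emeasure_space_1 M.emeasure_space_1
    by (simp add: emeasure_distr std_gaussian_def)
  then show ?thesis
    by (intro measure_eqI) (auto simp: dens)
qed

lemma norm_iexp_diff_le: "norm (iexp a - iexp b) \<le> \<bar>a - b\<bar>"
proof -
  have "iexp a - iexp b = iexp b * (iexp (a - b) - 1)"
    by (simp add: algebra_simps flip: exp_add)
  then show ?thesis
    using iexp_approx1[of "a - b" 0] by (simp add: norm_mult)
qed

text \<open>Integration by parts: the function \<open>x exp (i \<theta> x\<^sup>2 / 2)\<close> times the normal density vanishes at both infinities, so
its derivative integrates to zero.\<close>

lemma std_normal_stein:
  "(1 - \<i> * \<theta>) * (CLINT x|std_normal_distribution. of_real (x\<^sup>2) * iexp (\<theta> * x\<^sup>2 / 2))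
     = (CLINT x|std_normal_distribution. iexp (\<theta> * x\<^sup>2 / 2))"
proof -
  let ?n = std_normal_density
  let ?e = "\<lambda>x. iexp (\<theta> * x\<^sup>2 / 2)"
  let ?F = "\<lambda>x::real. complex_of_real (x * ?n x) * ?e x"
  let ?f = "\<lambda>x::real. ?n x *\<^sub>R ?e x - (1 - \<i> * \<theta>) * (?n x *\<^sub>R (of_real (x\<^sup>2) * ?e x))"
  have int0: "integrable lborel (\<lambda>x. ?n x *\<^sub>R ?e x)"
    by (rule Bochner_Integration.integrable_bound[where f = "?n"]) (auto simp: normal_density_nonneg)
  have int2: "integrable lborel (\<lambda>x. ?n x *\<^sub>R (of_real (x\<^sup>2) * ?e x))"
    by (rule Bochner_Integration.integrable_bound[OF integrable_std_normal_moment[of 2]])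
      (auto simp: normal_density_nonneg norm_mult norm_power)
  have intf: "integrable lborel ?f"
    by (intro Bochner_Integration.integrable_diff int0 integrable_mult_right int2)
  have deriv: "(?F has_vector_derivative ?f x) (at x)" for x
  proof -
    have n: "(\<lambda>x. of_real (?n x) :: complex) = (\<lambda>x. exp (- (of_real x)\<^sup>2 / 2) / of_real (sqrt (2 * pi)))"
      by (auto simp: std_normal_density_def exp_of_real[symmetric] fun_eq_iff)
    have "((\<lambda>z. z * (exp (- z\<^sup>2 / 2) / of_real (sqrt (2 * pi))) * exp (\<i> * (\<theta> * z\<^sup>2 / 2))) has_field_derivative ?f x)
       (at (complex_of_real x))"
      unfolding scaleR_conv_of_real n[THEN fun_cong]
      by (auto intro!: derivative_eq_intros simp: field_simps power2_eq_square)
    from has_vector_derivative_real_field[OF this] show ?thesis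
      by (simp add: n[THEN fun_cong])
  qed
  have lim: "((\<lambda>x. x * ?n x) \<longlongrightarrow> 0) at_top" "((\<lambda>x. x * ?n x) \<longlongrightarrow> 0) at_bot"
    unfolding std_normal_density_def by real_asymp+
  have limF: "(?F \<longlongrightarrow> 0) G" if "((\<lambda>x. x * ?n x) \<longlongrightarrow> 0) G" for G
  proof (rule tendsto_norm_zero_cancel)
    have "norm (?F x) = \<bar>x * ?n x\<bar>" for x
      by (simp add: norm_mult abs_mult)
    then show "((\<lambda>x. norm (?F x)) \<longlongrightarrow> 0) G" using tendsto_rabs_zero[OF that] by simp
  qed
  have "(LBINT x=-\<infinity>..\<infinity>. ?f x) = 0 - 0"
  proof (rule interval_integral_FTC_integrable[where F = ?F])
    show "set_integrable lborel (einterval (- \<infinity>) \<infinity>) ?f"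
      using intf by (simp add: set_integrable_def)
    show "((?F \<circ> real_of_ereal) \<longlongrightarrow> 0) (at_right (- \<infinity>))" "((?F \<circ> real_of_ereal) \<longlongrightarrow> 0) (at_left \<infinity>)"
      unfolding ereal_tendsto_simps by (intro limF lim)+
    show "isCont ?f x" for x
      unfolding std_normal_density_def by (intro continuous_intros) auto
    show "(?F has_vector_derivative ?f x) (at x)" for x by (rule deriv)
  qed auto
  then have "(CLBINT x. ?f x) = 0"
    by (simp add: interval_lebesgue_integral_def set_lebesgue_integral_def)
  then have "(CLBINT x. ?n x *\<^sub>R ?e x) = (1 - \<i> * \<theta>) * (CLBINT x. ?n x *\<^sub>R (of_real (x\<^sup>2) * ?e x))"
    unfolding Bochner_Integration.integral_diff[OF int0 integrable_mult_right[OF int2]] integral_mult_right_zero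
    by (simp only: right_minus_eq)
  then show ?thesis
    by (simp add: integral_density normal_density_nonneg)
qed

text \<open>Differentiation under the integral and \<open>std_normal_stein\<close> give the differential equation
\<open>f' = i f / (2 (1 - i \<theta>))\<close>. Its solution is the principal branch of \<open>(1 - i \<theta>)\<^sup>-\<^sup>1\<^sup>/\<^sup>2\<close>, which is smooth along the whole
line because \<open>1 - i \<theta>\<close> has real part \<open>1\<close>; the quotient of the two functions is therefore constant.\<close>

lemma std_normal_half_square_cf:
  "(CLINT x|std_normal_distribution. iexp (\<theta> * x\<^sup>2 / 2)) = exp (- Ln (1 - \<i> * \<theta>) / 2)"
proof -
  let ?N = std_normal_distribution
  interpret N: real_distribution ?N by (rule real_dist_normal_dist)
  let ?e = "\<lambda>\<theta> x. iexp (\<theta> * x\<^sup>2 / 2)"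
  define f where "f \<theta> = (CLINT x|?N. ?e \<theta> x)" for \<theta>
  have inte: "integrable ?N (?e \<theta>)" for \<theta>
    by (rule N.integrable_const_bound[where B = 1]) auto
  have deriv: "(f has_vector_derivative \<i> / (2 * (1 - \<i> * \<theta>)) * f \<theta>) (at \<theta>)" for \<theta>
  proof -
    have nz: "1 - \<i> * complex_of_real \<theta> \<noteq> 0"
      using one_minus_i_not_nonpos by force
    have "(CLINT x|?N. \<i> * of_real (x\<^sup>2 / 2) * ?e \<theta> x) = \<i> / 2 * (CLINT x|?N. of_real (x\<^sup>2) * ?e \<theta> x)"
      by (simp add: mult.assoc flip: integral_mult_right_zero)
    also have "\<dots> = \<i> / (2 * (1 - \<i> * \<theta>)) * f \<theta>"
      unfolding f_def std_normal_stein[symmetric] using nz by (simp add: field_simps)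
    finally have D: "(CLINT x|?N. \<i> * of_real (x\<^sup>2 / 2) * ?e \<theta> x) = \<i> / (2 * (1 - \<i> * \<theta>)) * f \<theta>" .
    show ?thesis
      unfolding has_vector_derivative_iff_difference_quotient tendsto_at_iff_sequentially comp_def D[symmetric]
    proof (intro allI impI)
      fix X :: "nat \<Rightarrow> real" assume neq: "\<forall>i. X i \<in> UNIV - {\<theta>}" and X: "X \<longlonglongrightarrow> \<theta>"
      let ?s = "\<lambda>n x. (?e (X n) x - ?e \<theta> x) /\<^sub>R (X n - \<theta>)"
      have "(\<lambda>n. CLINT x|?N. ?s n x) \<longlonglongrightarrow> (CLINT x|?N. \<i> * of_real (x\<^sup>2 / 2) * ?e \<theta> x)"
      proof (rule integral_dominated_convergence[where w = "\<lambda>x. x\<^sup>2 / 2"])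
        show "integrable ?N (\<lambda>x. x\<^sup>2 / 2)"
          using integrable_std_normal_distribution_moment[of 2] by simp
        have "norm (?s n x) \<le> x\<^sup>2 / 2" for n x
        proof -
          have "norm (?e (X n) x - ?e \<theta> x) \<le> \<bar>X n - \<theta>\<bar> * (x\<^sup>2 / 2)"
            using norm_iexp_diff_le[of "X n * x\<^sup>2 / 2" "\<theta> * x\<^sup>2 / 2"]
            by (simp add: abs_mult flip: diff_divide_distrib left_diff_distrib)
          then show ?thesis
            using neq by (simp add: divide_simps mult_ac)
        qed
        then show "AE x in ?N. norm (?s n x) \<le> x\<^sup>2 / 2" for n by simp
        have "(\<lambda>n. ?s n x) \<longlonglongrightarrow> \<i> * of_real (x\<^sup>2 / 2) * ?e \<theta> x" for x
        proof -
          have "((\<lambda>z. exp (\<i> * (z * of_real (x\<^sup>2) / 2))) has_field_derivative \<i> * of_real (x\<^sup>2 / 2) * ?e \<theta> x) (at (complex_of_real \<theta>))"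
            by (auto intro!: derivative_eq_intros)
          from has_vector_derivative_real_field[OF this]
          have "((\<lambda>\<theta>. ?e \<theta> x) has_vector_derivative \<i> * of_real (x\<^sup>2 / 2) * ?e \<theta> x) (at \<theta>)"
            by simp
          then show ?thesis
            unfolding has_vector_derivative_iff_difference_quotient tendsto_at_iff_sequentially comp_def
            using neq X by blast
        qed
        then show "AE x in ?N. (\<lambda>n. ?s n x) \<longlonglongrightarrow> \<i> * of_real (x\<^sup>2 / 2) * ?e \<theta> x" by simp
      qed measurable
      moreover have "(CLINT x|?N. ?s n x) = (f (X n) - f \<theta>) /\<^sub>R (X n - \<theta>)" for n
        unfolding f_def Bochner_Integration.integral_diff[OF inte inte, symmetric] by simp
      ultimately show "(\<lambda>n. (f (X n) - f \<theta>) /\<^sub>R (X n - \<theta>)) \<longlonglongrightarrow> (CLINT x|?N. \<i> * of_real (x\<^sup>2 / 2) * ?e \<theta> x)"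
        by (simp only:)
    qed
  qed
  define h where "h \<theta> = exp (Ln (1 - \<i> * complex_of_real \<theta>) / 2)" for \<theta>
  have hd: "(h has_vector_derivative - (\<i> / (2 * (1 - \<i> * \<theta>))) * h \<theta>) (at \<theta>)" for \<theta>
  proof -
    have "((\<lambda>z. 1 - \<i> * z) has_field_derivative - \<i>) (at (complex_of_real \<theta>))"
      by (auto intro!: derivative_eq_intros)
    from DERIV_chain2[OF has_field_derivative_Ln[OF one_minus_i_not_nonpos] this]
    have "((\<lambda>z. Ln (1 - \<i> * z)) has_field_derivative inverse (1 - \<i> * \<theta>) * - \<i>) (at (complex_of_real \<theta>))" .
    from has_vector_derivative_real_field[OF DERIV_chain2[OF DERIV_exp DERIV_cdivide[OF this, of 2]]]
    have "(h has_vector_derivative h \<theta> * (inverse (1 - \<i> * \<theta>) * - \<i> / 2)) (at \<theta>)"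
      unfolding h_def .
    also have "h \<theta> * (inverse (1 - \<i> * \<theta>) * - \<i> / 2) = - (\<i> / (2 * (1 - \<i> * \<theta>))) * h \<theta>"
      by (simp only: divide_inverse inverse_mult_distrib mult_minus_left mult_minus_right mult_ac)
    finally show ?thesis .
  qed
  have "((\<lambda>\<theta>. f \<theta> * h \<theta>) has_vector_derivative 0) (at \<theta>)" for \<theta>
    using has_vector_derivative_mult[OF deriv hd, of \<theta>] by (simp add: algebra_simps)
  then obtain c where c: "\<And>\<theta>. f \<theta> * h \<theta> = c"
    using has_vector_derivative_zero_constant[of UNIV "\<lambda>\<theta>. f \<theta> * h \<theta>"] by auto
  have "f 0 * h 0 = 1"
    using N.prob_space by (simp add: f_def h_def)
  then have "f \<theta> * h \<theta> = 1" using c by metis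
  then have "f \<theta> = inverse (h \<theta>)" by (metis inverse_unique mult.commute)
  then show ?thesis by (simp add: f_def h_def exp_minus)
qed

lemma std_normal_centred_half_square_cf:
  "(CLINT x|std_normal_distribution. iexp (\<theta> * (x\<^sup>2 - 1) / 2)) = exp (log_cf \<theta>)"
proof -
  have "iexp (\<theta> * (x\<^sup>2 - 1) / 2) = exp (- (\<i> * \<theta>) / 2) * iexp (\<theta> * x\<^sup>2 / 2)" for x
    by (simp add: algebra_simps diff_divide_distrib flip: exp_add)
  then have "(CLINT x|std_normal_distribution. iexp (\<theta> * (x\<^sup>2 - 1) / 2))
      = exp (- (\<i> * \<theta>) / 2) * exp (- Ln (1 - \<i> * \<theta>) / 2)"
    by (simp only: integral_mult_right_zero std_normal_half_square_cf)
  then show ?thesis by (simp add: log_cf_def flip: exp_add)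
qed

section \<open>The normal approximation of the standardized score\<close>

text \<open>The rotation that diagonalizes \<open>D\<close>, composed with the whitening of \<open>Y\<close>, produces a standard Gaussian vector in
whose coordinates the quadratic form is diagonal. The rest is Fourier inversion with the bounds of the
previous sections.\<close>

lemma gaussian_quadratic_form_density:
  fixes S D :: "real ^ 'n ^ 'n" and Y :: "'a \<Rightarrow> real ^ 'n"
  assumes M: "prob_space M"
    and Y: "distributed M lborel Y (\<lambda>y. ennreal (mvnormal_density 0 S y))"
    and S: "transpose S = S" "\<And>x. x \<noteq> 0 \<Longrightarrow> 0 < x \<bullet> (S *v x)"
    and D: "transpose D = D" "(norm D)\<^sup>2 = 2" "spectral_norm D \<le> sqrt 2 * a"
    and a8: "8 * a\<^sup>2 < 1"
  defines "R \<equiv> \<lambda>\<omega>. inv_msqrt S *v Y \<omega>"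
  shows "\<exists>g. continuous_density M (\<lambda>\<omega>. (R \<omega> \<bullet> (D *v R \<omega>) - trace D) / 2) g \<and>
      (\<forall>t. \<bar>g t - std_normal_density t\<bar> \<le> 0.14 * (4 + 0.29 / (1 - 8 * a\<^sup>2)\<^sup>2) * a)"
proof -
  interpret M: prob_space M by (rule M)
  interpret N: real_distribution std_normal_distribution by (rule real_dist_normal_dist)
  have Ym [measurable]: "Y \<in> borel_measurable M"
    using distributed_measurable[OF Y] by simp
  define K where "K = inv_msqrt S"
  have K: "transpose K = K" "invertible K" "matrix_inv S = K ** K"
    using inv_msqrt_pos_def[OF S] by (simp_all add: K_def)
  obtain Q d where Q: "orthogonal_matrix Q" and DQ: "D = Q ** diag_mat d ** transpose Q"
    using symmetric_matrix_diagonalization[OF D(1)] .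
  have QQ: "transpose Q ** Q = mat 1" using Q by (simp add: orthogonal_matrix_def)
  have oQ: "orthogonal_matrix (transpose Q)" using Q by (simp add: orthogonal_matrix_def)
  have var: "(\<Sum>i\<in>UNIV. (d $ i)\<^sup>2) = 2"
  proof -
    have "D ** D = Q ** (diag_mat d ** (transpose Q ** Q) ** diag_mat d) ** transpose Q"
      by (simp add: DQ matrix_mul_assoc)
    also have "\<dots> = Q ** (diag_mat (\<chi> i. d $ i * d $ i) ** transpose Q)"
      by (simp add: QQ diag_mat_mul matrix_mul_assoc)
    also have "trace \<dots> = trace (diag_mat (\<chi> i. d $ i * d $ i))"
      by (subst trace_mul_sym) (simp add: QQ flip: matrix_mul_assoc)
    finally show ?thesis
      using D(2) trace_symmetric_square[OF D(1)] by (simp add: trace_diag_mat power2_eq_square)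
  qed
  have tr: "trace D = (\<Sum>i\<in>UNIV. d $ i)"
    unfolding DQ by (subst matrix_mul_assoc[symmetric], subst trace_mul_sym)
      (simp add: QQ trace_diag_mat flip: matrix_mul_assoc)
  have max: "\<bar>d $ i\<bar> \<le> sqrt 2 * a" for i
    using eigenvalue_le_spectral_norm[OF Q DQ, of i] D(3) by linarith
  \<comment> \<open>a nonpositive \<open>a\<close> would force all eigenvalues to vanish\<close>
  have a: "0 < a"
  proof (rule ccontr)
    assume "\<not> 0 < a"
    then have "sqrt 2 * a \<le> 0" by (simp add: mult_le_0_iff)
    then have "\<bar>d $ i\<bar> \<le> 0" for i using max[of i] by linarith
    then have "d $ i = 0" for i by simp
    then show False using var by simp
  qed

  define L where "L = (\<lambda>y. (transpose Q ** K) *v y)"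
  have linL: "linear L" unfolding L_def by simp
  have bijL: "bij L"
  proof -
    have "invertible (transpose Q)" using oQ unfolding orthogonal_matrix_def invertible_def by blast
    then show ?thesis
      unfolding L_def invertible_eq_bij[symmetric] using K(2) by (rule invertible_mult)
  qed
  have normL: "(norm (L y))\<^sup>2 = y \<bullet> (matrix_inv S *v y)" for y
  proof -
    have "norm (L y) = norm (K *v y)"
      using orthogonal_transformation_norm[OF orthogonal_transformation_matrix[THEN iffD2, of "(*v) (transpose Q)"]] oQ
      by (simp add: L_def flip: matrix_vector_mul_assoc)
    then have "(norm (L y))\<^sup>2 = (K *v y) \<bullet> (K *v y)" by (simp add: power2_norm_eq_inner)
    also have "\<dots> = y \<bullet> (K *v (K *v y))" by (rule inner_symmetric_mat[OF K(1)])
    finally show ?thesis by (simp add: K(3) matrix_vector_mul_assoc)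
  qed
  have "distributed M lborel Y (\<lambda>y. ennreal ((1 / sqrt ((2 * pi) ^ CARD('n) * det S)) * exp (- (norm (L y))\<^sup>2 / 2)))"
    using Y by (simp add: mvnormal_density_def normL)
  from distr_linear_std_gaussian[OF M linL bijL this]
  have X: "distr M borel (\<lambda>\<omega>. L (Y \<omega>)) = std_gaussian" .

  define h where "h = (\<lambda>x :: real ^ 'n. \<Sum>i\<in>UNIV. d $ i * ((x $ i)\<^sup>2 - 1) / 2)"
  define T where "T = (\<lambda>\<omega>. (R \<omega> \<bullet> (D *v R \<omega>) - trace D) / 2)"
  have [measurable]: "h \<in> borel_measurable borel" unfolding h_def by measurable
  have [measurable]: "L \<in> borel_measurable borel"
    using linear_continuous_on_compose[OF continuous_on_id linL]
    by (intro borel_measurable_continuous_onI) auto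
  have T: "T = (\<lambda>\<omega>. h (L (Y \<omega>)))"
    unfolding T_def h_def R_def quadratic_form_diagonalized[OF DQ] tr L_def K_def[symmetric]
    by (simp add: matrix_vector_mul_assoc right_diff_distrib sum_subtractf flip: sum_divide_distrib)
  have [measurable]: "T \<in> borel_measurable M" unfolding T by measurable
  define \<phi> where "\<phi> = char (distr M borel T)"
  have \<phi>: "\<phi> s = (\<Prod>i\<in>UNIV. exp (log_cf (s * d $ i)))" for s
  proof -
    have "\<phi> s = (CLINT \<omega>|M. iexp (s * h (L (Y \<omega>))))"
      unfolding \<phi>_def char_def T by (rule integral_distr) measurable
    also have "\<dots> = (CLINT x|std_gaussian. iexp (s * h x))"
      unfolding X[symmetric] by (rule integral_distr[symmetric]) measurable
    also have "\<dots> = (CLINT x|std_gaussian. \<Prod>i\<in>UNIV. iexp (s * d $ i * ((x $ i)\<^sup>2 - 1) / 2))"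
      unfolding h_def by (simp add: exp_sum[symmetric] sum_distrib_left mult.assoc)
    also have "\<dots> = (\<Prod>i\<in>UNIV. CLINT x|std_normal_distribution. iexp (s * d $ i * (x\<^sup>2 - 1) / 2))"
      by (rule integral_std_gaussian_prod) (rule N.integrable_const_bound[where B = 1]; simp)
    finally show ?thesis by (simp only: std_normal_centred_half_square_cf)
  qed

  define w where "w = (\<lambda>s. (1 + 2 * a\<^sup>2 * s\<^sup>2) powr (- (1 / (4 * a\<^sup>2))))"
  have w1: "norm (\<phi> s) \<le> w s"
    and w2: "norm (\<phi> s - exp (- s\<^sup>2 / 2)) \<le> sqrt 2 / 6 * a * (\<bar>s\<bar> ^ 3 * w s + \<bar>s\<bar> ^ 3 * exp (- s\<^sup>2 / 2))" for s
    unfolding \<phi> w_def using standardized_quadratic_cf_bounds[OF a var max] by blast+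
  have wint: "has_bochner_integral lborel (\<lambda>s. \<bar>s\<bar> ^ 3 * w s) (4 / ((1 - 4 * a\<^sup>2) * (1 - 8 * a\<^sup>2)))"
  proof -
    have k: "2 < 1 / (4 * a\<^sup>2)" "0 < 2 * a\<^sup>2" using a a8 by (simp_all add: field_simps)
    have "1 / ((2 * a\<^sup>2)\<^sup>2 * (1 / (4 * a\<^sup>2) - 1) * (1 / (4 * a\<^sup>2) - 2)) = 4 / ((1 - 4 * a\<^sup>2) * (1 - 8 * a\<^sup>2))"
      using a a8 by (simp add: divide_simps)
    then show ?thesis
      unfolding w_def using has_bochner_integral_cubed_rational_weight[OF k(2,1)] by simp
  qed
  have w0: "w s \<ge> 0" "w s \<le> 1" for s
  proof -
    show "w s \<ge> 0" by (simp add: w_def)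
    have "w s \<le> (1 + 2 * a\<^sup>2 * s\<^sup>2) powr 0" unfolding w_def by (rule powr_mono) auto
    then show "w s \<le> 1" by (simp add: w_def add_pos_nonneg less_imp_neq[symmetric] split: if_splits)
  qed
  interpret D: real_distribution "distr M borel T" by simp
  have \<phi>_int: "integrable lborel \<phi>"
  proof (rule Bochner_Integration.integrable_bound)
    show "integrable lborel (\<lambda>s. indicator {-1..1} s + \<bar>s\<bar> ^ 3 * w s)"
      using wint by (intro Bochner_Integration.integrable_add integrable_real_indicator) (auto simp: has_bochner_integral_iff)
    show "\<phi> \<in> borel_measurable lborel" unfolding \<phi>_def by simp
    \<comment> \<open>near the origin \<open>w\<close> is bounded, elsewhere it is dominated by its product with \<open>\<bar>s\<bar>\<^sup>3\<close>\<close>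
    have "w s \<le> indicator {-1..1} s + \<bar>s\<bar> ^ 3 * w s" for s
    proof (cases "\<bar>s\<bar> \<le> 1")
      case True
      then show ?thesis using w0[of s] by (auto simp: indicator_def abs_le_iff intro: add_increasing2)
    next
      case False
      then have "1 * w s \<le> \<bar>s\<bar> ^ 3 * w s" using w0[of s] by (intro mult_right_mono one_le_power) auto
      then show ?thesis by (simp add: add_increasing)
    qed
    then have "norm (\<phi> s) \<le> norm (indicator {-1..1} s + \<bar>s\<bar> ^ 3 * w s)" for s
      using w1[of s] by (smt (verit) real_norm_def)
    then show "AE s in lborel. norm (\<phi> s) \<le> norm (indicator {-1..1} s + \<bar>s\<bar> ^ 3 * w s)" by simp
  qed
  have gauss_int: "integrable lborel (\<lambda>t. complex_of_real (exp (- t\<^sup>2 / 2)))"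
    using std_normal_cf_integrable by simp
  define g where "g = (\<lambda>t. Re (inverse_fourier \<phi> t))"
  have "continuous_density M T g"
    unfolding g_def \<phi>_def
    by (rule M.continuous_density_of_integrable_char) (use \<phi>_int in \<open>auto simp: \<phi>_def\<close>)
  moreover have "\<bar>g t - std_normal_density t\<bar> \<le> 0.14 * (4 + 0.29 / (1 - 8 * a\<^sup>2)\<^sup>2) * a" for t
  proof -
    have "has_bochner_integral lborel (\<lambda>s. sqrt 2 / 6 * a * (\<bar>s\<bar> ^ 3 * w s + \<bar>s\<bar> ^ 3 * exp (- s\<^sup>2 / 2)))
       (sqrt 2 / 6 * a * (4 / ((1 - 4 * a\<^sup>2) * (1 - 8 * a\<^sup>2)) + 4))"
      by (intro has_bochner_integral_mult_right has_bochner_integral_add wint has_bochner_integral_cubed_gaussian)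
    from inverse_fourier_diff_bound[OF \<phi>_int gauss_int this w2]
    have "\<bar>g t - std_normal_density t\<bar>
        \<le> 1 / (2 * pi) * (sqrt 2 / 6 * a * (4 / ((1 - 4 * a\<^sup>2) * (1 - 8 * a\<^sup>2)) + 4))"
      unfolding g_def std_normal_inverse_fourier .
    also have "\<dots> \<le> 0.14 * (4 + 0.29 / (1 - 8 * a\<^sup>2)\<^sup>2) * a"
      by (rule integrated_bound_le_stated_constant[OF a a8])
    finally show ?thesis .
  qed
  ultimately show ?thesis unfolding T_def by blast
qed

lemma transpose_eq_iff: "transpose A = A \<longleftrightarrow> (\<forall>i j. A $ i $ j = A $ j $ i)"
  by (auto simp: transpose_def vec_eq_iff)

lemma Sigma_mat_symmetric:
  assumes "covariance_pattern H l"
  shows "transpose (Sigma_mat Z H l v) = Sigma_mat Z H l v"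
proof -
  have add: "transpose (A + B) = transpose A + transpose B" for A B :: "real ^ 'c ^ 'c"
    by (simp add: transpose_def vec_eq_iff)
  have "transpose (Psi H v) = Psi H v" using assms by (simp add: covariance_pattern_def)
  then show ?thesis
    by (simp add: Sigma_mat_def add matrix_transpose_mul matrix_mul_assoc transpose_scalar)
qed

lemma Sigma_mat_pos_def:
  assumes "\<psi> \<in> param_set H l" "x \<noteq> 0"
  shows "0 < x \<bullet> (Sigma_mat Z H l \<psi> *v x)"
proof -
  have l: "0 < \<psi> $ l" and P: "0 \<le> y \<bullet> (Psi H \<psi> *v y)" for y
    using assms(1) by (auto simp: param_set_def psd_def)
  have "x \<bullet> (Sigma_mat Z H l \<psi> *v x) = (transpose Z *v x) \<bullet> (Psi H \<psi> *v (transpose Z *v x)) + \<psi> $ l * (x \<bullet> x)"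
    by (simp add: Sigma_mat_def matrix_vector_mult_add_rdistrib inner_add_right dot_lmul_matrix
        transpose_matrix_vector scaleR_matrix_vector_assoc[symmetric] flip: matrix_vector_mul_assoc)
  then show ?thesis using l P assms(2) by (simp add: add_nonneg_pos)
qed

lemma A_mat_symmetric:
  assumes "covariance_pattern H l" "\<psi> \<in> param_set H l"
  shows "transpose (A_mat Z H l \<psi> j) = A_mat Z H l \<psi> j"
proof -
  have "transpose (inv_msqrt (Sigma_mat Z H l \<psi>)) = inv_msqrt (Sigma_mat Z H l \<psi>)"
    by (rule inv_msqrt_pos_def(1)[OF Sigma_mat_symmetric[OF assms(1)] Sigma_mat_pos_def[OF assms(2)]])
  moreover have "transpose (Sigma_mat Z H l (axis j 1)) = Sigma_mat Z H l (axis j 1)"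
    by (rule Sigma_mat_symmetric[OF assms(1)])
  ultimately show ?thesis
    by (simp add: A_mat_def dSigma_eq_Sigma_mat matrix_transpose_mul matrix_mul_assoc)
qed

lemma A_dir_symmetric:
  assumes "covariance_pattern H l" "\<psi> \<in> param_set H l"
  shows "transpose (A_dir Z H l v \<psi>) = A_dir Z H l v \<psi>"
proof -
  have "A_mat Z H l \<psi> k $ i $ j = A_mat Z H l \<psi> k $ j $ i" for i j k
    using A_mat_symmetric[OF assms, of Z k] unfolding transpose_eq_iff by blast
  then show ?thesis
    unfolding transpose_eq_iff A_dir_def by (simp add: sum_component)
qed

lemma A_dir_scaleR: "A_dir Z H l (c *\<^sub>R v) \<psi> = c *\<^sub>R A_dir Z H l v \<psi>"
  by (simp add: A_dir_def scaleR_sum_right)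

lemma trace_sum_scaleR_mult:
  fixes A :: "'r::finite \<Rightarrow> real ^ 'n ^ 'n"
  shows "trace ((\<Sum>j\<in>UNIV. c j *\<^sub>R A j) ** B) = (\<Sum>j\<in>UNIV. c j * trace (A j ** B))"
proof -
  have "linear (\<lambda>X :: real ^ 'n ^ 'n. trace (X ** B))"
    by (rule linearI) (simp_all add: trace_def matrix_matrix_mult_def sum.distrib sum_distrib_left algebra_simps)
  then interpret linear "\<lambda>X :: real ^ 'n ^ 'n. trace (X ** B)" .
  show ?thesis by (simp add: sum scale)
qed

text \<open>The Fisher information is the Gram matrix of the \<open>A\<^sub>j\<close> for half the Frobenius inner product.\<close>

lemma fisher_info_form:
  assumes "covariance_pattern H l" "\<psi> \<in> param_set H l"
  shows "v \<bullet> (fisher_info Z H l \<psi> *v v) = (norm (A_dir Z H l v \<psi>))\<^sup>2 / 2"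
proof -
  have "(norm (A_dir Z H l v \<psi>))\<^sup>2 = trace (A_dir Z H l v \<psi> ** A_dir Z H l v \<psi>)"
    by (rule trace_symmetric_square[OF A_dir_symmetric[OF assms], symmetric])
  also have "\<dots> = (\<Sum>i\<in>UNIV. v $ i * (\<Sum>j\<in>UNIV. v $ j * trace (A_mat Z H l \<psi> i ** A_mat Z H l \<psi> j)))"
  proof -
    have inner: "trace (A_mat Z H l \<psi> i ** A_dir Z H l v \<psi>) =
        (\<Sum>j\<in>UNIV. v $ j * trace (A_mat Z H l \<psi> i ** A_mat Z H l \<psi> j))" for i
    proof -
      have "trace (A_mat Z H l \<psi> i ** A_dir Z H l v \<psi>) = trace (A_dir Z H l v \<psi> ** A_mat Z H l \<psi> i)"
        by (rule trace_mul_sym)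
      also have "\<dots> = (\<Sum>j\<in>UNIV. v $ j * trace (A_mat Z H l \<psi> j ** A_mat Z H l \<psi> i))"
        unfolding A_dir_def by (rule trace_sum_scaleR_mult)
      also have "\<dots> = (\<Sum>j\<in>UNIV. v $ j * trace (A_mat Z H l \<psi> i ** A_mat Z H l \<psi> j))"
        by (intro sum.cong refl arg_cong2[where f = "(*)"] trace_mul_sym)
      finally show ?thesis .
    qed
    have "trace (A_dir Z H l v \<psi> ** A_dir Z H l v \<psi>) = (\<Sum>i\<in>UNIV. v $ i * trace (A_mat Z H l \<psi> i ** A_dir Z H l v \<psi>))"
      by (subst A_dir_def) (rule trace_sum_scaleR_mult)
    then show ?thesis by (simp only: inner)
  qed
  finally show ?thesis
    by (simp add: fisher_info_def inner_vec_def matrix_vector_mult_def sum_divide_distrib sum_distrib_left mult_ac)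
qed

lemma inner_score:
  "u \<bullet> score Z H l \<psi> y =
     (let R = inv_msqrt (Sigma_mat Z H l \<psi>) *v y in (R \<bullet> (A_dir Z H l u \<psi> *v R) - trace (A_dir Z H l u \<psi>)) / 2)"
proof -
  define R where "R = inv_msqrt (Sigma_mat Z H l \<psi>) *v y"
  have 1: "trace (A_dir Z H l u \<psi>) = (\<Sum>j\<in>UNIV. u $ j * trace (A_mat Z H l \<psi> j))"
    using trace_sum_scaleR_mult[of "\<lambda>j. u $ j" "A_mat Z H l \<psi>" "mat 1"] by (simp add: A_dir_def)
  have "linear (\<lambda>X. R \<bullet> (X *v R))"
    by (rule linearI) (simp_all add: matrix_vector_mult_add_rdistrib inner_add_right flip: scaleR_matrix_vector_assoc)
  then interpret linear "\<lambda>X. R \<bullet> (X *v R)" .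
  have 2: "R \<bullet> (A_dir Z H l u \<psi> *v R) = (\<Sum>j\<in>UNIV. u $ j * (R \<bullet> (A_mat Z H l \<psi> j *v R)))"
    by (simp add: A_dir_def sum scale)
  show ?thesis
    unfolding Let_def R_def[symmetric] 1 2
    by (simp add: score_def Let_def inner_vec_def right_diff_distrib sum_subtractf flip: R_def sum_divide_distrib)
qed

theorem lemma5:
  fixes Z :: "real ^ 'q ^ 'n"
    and H :: "'r::finite \<Rightarrow> real ^ 'q ^ 'q"
    and l :: 'r
    and \<psi> :: "real ^ 'r"
    and abar :: real
    and M :: "'a measure"
    and Y :: "'a \<Rightarrow> real ^ 'n"
  assumes "covariance_pattern H l"
    and "\<psi> \<in> param_set H l"
    and "prob_space M"
    and "distributed M lborel Y (\<lambda>y. ennreal (mvnormal_density 0 (Sigma_mat Z H l \<psi>) y))"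
    and "abar\<^sup>2 < 1 / 8"
    and "\<And>v. v \<in> sphere 0 1 \<Longrightarrow> a_ratio Z H l v \<psi> \<le> abar"
  shows "\<forall>v \<in> sphere 0 1. \<exists>g.
           continuous_density M (\<lambda>\<omega>. v \<bullet> std_score Z H l \<psi> (Y \<omega>)) g \<and>
           (\<forall>t. \<bar>g t - std_normal_density t\<bar>
                  \<le> 0.14 * (4 + 0.29 / (1 - 8 * abar\<^sup>2)\<^sup>2) * abar)"
proof
  fix v :: "real ^ 'r" assume v: "v \<in> sphere 0 1"
  let ?A = "\<lambda>u. A_dir Z H l u \<psi>"
  have unit: "?A u \<noteq> 0 \<and> spectral_norm (?A u) \<le> abar * norm (?A u)" if "u \<in> sphere 0 1" for u
  proof (cases "?A u = 0")
    case True
    \<comment> \<open>here the ratio takes its default value \<open>1\<close>, which the bound on \<open>abar\<close> excludes\<close>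
    then have "1 \<le> abar" using assms(6)[OF that] by (simp add: a_ratio_def frobenius_norm_eq_norm)
    then have "1 \<le> abar\<^sup>2" by simp
    then show ?thesis using assms(5) by simp
  next
    case False
    then have "spectral_norm (?A u) / norm (?A u) \<le> abar"
      using assms(6)[OF that] by (simp add: a_ratio_def frobenius_norm_eq_norm)
    then show ?thesis using False by (simp add: divide_le_eq)
  qed
  \<comment> \<open>the ratio is invariant under scaling, so the bound extends from the sphere to all directions\<close>
  have dir: "?A u \<noteq> 0" "spectral_norm (?A u) \<le> abar * norm (?A u)" if "u \<noteq> 0" for u
  proof -
    define e where "e = u /\<^sub>R norm u"
    have e: "e \<in> sphere 0 1" "u = norm u *\<^sub>R e" using that by (simp_all add: e_def)
    have A: "?A u = norm u *\<^sub>R ?A e" by (subst e(2)) (rule A_dir_scaleR)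
    show "?A u \<noteq> 0" using unit[OF e(1)] that by (simp add: A)
    have "spectral_norm (?A u) = norm u * spectral_norm (?A e)"
    proof -
      have "onorm (\<lambda>x. norm u *\<^sub>R (?A e *v x)) = \<bar>norm u\<bar> * onorm (\<lambda>x. ?A e *v x)"
        by (rule onorm_scaleR) (rule matrix_vector_mul_bounded_linear)
      then show ?thesis
        unfolding A spectral_norm_def by (simp add: scaleR_matrix_vector_assoc)
    qed
    then show "spectral_norm (?A u) \<le> abar * norm (?A u)"
      using mult_left_mono[OF conjunct2[OF unit[OF e(1)]], of "norm u"] by (simp add: A mult_ac)
  qed
  define F where "F = fisher_info Z H l \<psi>"
  have symF: "transpose F = F"
    unfolding transpose_eq_iff F_def fisher_info_def
    using trace_mul_sym[of "A_mat Z H l \<psi> i" "A_mat Z H l \<psi> j" for i j] by auto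
  have posF: "0 < x \<bullet> (F *v x)" if "x \<noteq> 0" for x
    using dir(1)[OF that] by (simp add: F_def fisher_info_form[OF assms(1,2)])
  define u where "u = inv_msqrt F *v v"
  note KF = inv_msqrt_pos_def[OF symF posF]
  have "u \<bullet> (F *v u) = v \<bullet> (inv_msqrt F *v (F *v (inv_msqrt F *v v)))"
    unfolding u_def by (rule inner_symmetric_mat[OF KF(1)])
  also have "\<dots> = v \<bullet> ((inv_msqrt F ** F ** inv_msqrt F) *v v)"
    by (simp add: matrix_vector_mul_assoc matrix_mul_assoc)
  also have "\<dots> = 1" using v by (simp add: KF(3) norm_eq_1)
  finally have uF: "u \<bullet> (F *v u) = 1" .
  then have A2: "(norm (?A u))\<^sup>2 = 2" by (simp add: F_def fisher_info_form[OF assms(1,2)])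
  have "u \<noteq> 0" using uF by auto
  moreover have "norm (?A u) = sqrt 2" using A2 by (metis norm_ge_zero real_sqrt_unique)
  ultimately have sp: "spectral_norm (?A u) \<le> sqrt 2 * abar"
    using dir(2) by (metis mult.commute)
  have a8: "8 * abar\<^sup>2 < 1" using assms(5) by simp
  have "v \<bullet> std_score Z H l \<psi> y = u \<bullet> score Z H l \<psi> y" for y
    unfolding std_score_def u_def F_def[symmetric] by (rule inner_symmetric_mat[OF KF(1), symmetric])
  then have score_eq: "v \<bullet> std_score Z H l \<psi> y =
      ((inv_msqrt (Sigma_mat Z H l \<psi>) *v y) \<bullet> (?A u *v (inv_msqrt (Sigma_mat Z H l \<psi>) *v y)) - trace (?A u)) / 2" for y
    by (simp only: inner_score Let_def)
  show "\<exists>g. continuous_density M (\<lambda>\<omega>. v \<bullet> std_score Z H l \<psi> (Y \<omega>)) g \<and>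
           (\<forall>t. \<bar>g t - std_normal_density t\<bar>
                  \<le> 0.14 * (4 + 0.29 / (1 - 8 * abar\<^sup>2)\<^sup>2) * abar)"
    unfolding score_eq
    by (rule gaussian_quadratic_form_density[OF assms(3,4) Sigma_mat_symmetric[OF assms(1)]
          Sigma_mat_pos_def[OF assms(2)] A_dir_symmetric[OF assms(1,2)] A2 sp a8])
qed

end
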